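(* Let $\mathfrak g$ be a finite-dimensional real Lie algebra that admits a $\mathfrak g$-invariant (positive definite) inner product, and let $\mathfrak h\subset\mathfrak g$ be a Lie subalgebra with $\dim\mathfrak g/\mathfrak h$ even, such that there exists a subalgebra $\mathfrak m$ of $\mathfrak g$ which is the centralizer of an abelian subalgebra of $\mathfrak g$ and satisfies $\mathfrak m\supset\mathfrak h$ and $[\mathfrak m,\mathfrak m]=[\mathfrak h,\mathfrak h]$. Then every $\mathfrak h$-invariant integrable complex structure on $\mathfrak g/\mathfrak h$ is equal to $J(\mathfrak p,J_1)$ for some parabolic subalgebra $\mathfrak p$ of $\mathfrak g_{\mathbb C}$ such that $\mathfrak m_{\mathfrak p}:=\mathfrak p\cap\mathfrak g$ satisfies $\mathfrak m_{\mathfrak p}\supset\mathfrak h$ and $[\mathfrak m_{\mathfrak p},\mathfrak m_{\mathfrak p}]=[\mathfrak h,\mathfrak h]$, and some complex structure $J_1$ on the real vector space $\mathfrak m_{\mathfrak p}/\mathfrak h$.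
   Context: Let $\pi:\mathfrak g_{\mathbb C}\to\mathfrak g_{\mathbb C}/\mathfrak h_{\mathbb C}=(\mathfrak g/\mathfrak h)_{\mathbb C}$ be the complex-linear extension of the natural surjection $\mathfrak g\to\mathfrak g/\mathfrak h$. A complex structure on a real vector space $V$ is $J\in\mathrm{End}(V)$ with $J^2=-\mathrm{id}$; $V_+\subset V_{\mathbb C}$ denotes the $\mathbf i$-eigenspace of its complex-linear extension. A complex subspace $X\subset V_{\mathbb C}$ with $\dim_{\mathbb C}X=\frac12\dim_{\mathbb R}V$ and $X\cap V=\{0\}$ equals $V_+$ for a unique complex structure on $V$. For $x\in\mathfrak h$, $\overline{ad}(x)$ is the endomorphism of $\mathfrak g/\mathfrak h$ induced by $ad(x)$. A complex structure $J$ on $\mathfrak g/\mathfrak h$ is $\mathfrak h$-invariant if $[J,\overline{ad}(x)]=0$ for all $x\in\mathfrak h$. It is then integrable if $N=0$, where $N(u,v)=\pi[x,y]+J(\pi[x',y]+\pi[x,y'])-\pi[x',y']$ for any $x,y,x',y'\in\mathfrak g$ with $\pi(x)=u$, $\pi(y)=v$, $\pi(x')=Ju$, $\pi(y')=Jv$ (the value is independent of the choices). A parabolic subalgebra of $\mathfrak g_{\mathbb C}$ is a complex subalgebra containing a Borel (maximal solvable) subalgebra of $\mathfrak g_{\mathbb C}$. Its nil-radical $\mathfrak n_{\mathfrak p}$ is the unique maximal ideal of $\mathfrak p$ consisting of nilpotent elements, where $x\in\mathfrak g_{\mathbb C}$ is nilpotent if $x\in[\mathfrak g_{\mathbb C},\mathfrak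 g_{\mathbb C}]$ and $ad(x)$ is nilpotent. For $\mathfrak p$ and $J_1$ as in the claim, let $(\mathfrak m_{\mathfrak p}/\mathfrak h)_+\subset(\mathfrak m_{\mathfrak p}/\mathfrak h)_{\mathbb C}\subset(\mathfrak g/\mathfrak h)_{\mathbb C}$ be the $\mathbf i$-eigenspace of $J_1$. Then $J(\mathfrak p,J_1)$ denotes the complex structure on $\mathfrak g/\mathfrak h$ whose $\mathbf i$-eigenspace $(\mathfrak g/\mathfrak h)_+$ satisfies $\pi^{-1}((\mathfrak g/\mathfrak h)_+)=\pi^{-1}((\mathfrak m_{\mathfrak p}/\mathfrak h)_+)\oplus\mathfrak n_{\mathfrak p}$; it is an $\mathfrak h$-invariant integrable complex structure restricting to $J_1$ on $\mathfrak m_{\mathfrak p}/\mathfrak h$. *)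

theory Defs
  imports "HOL-Analysis.Analysis" "HOL-Library.Set_Algebras"
begin

section \<open>Lie algebras over an arbitrary field\<close>

text \<open>The Lie algebra is the whole type \<open>'b\<close>. Both the real Lie algebra and its
  complexification below are instances.\<close>

locale lie_algebra = vector_space scale
  for scale :: "'f::field \<Rightarrow> 'b::ab_group_add \<Rightarrow> 'b" +
  fixes bracket :: "'b \<Rightarrow> 'b \<Rightarrow> 'b"
  assumes bracket_add_left: "bracket (x + y) z = bracket x z + bracket y z"
    and bracket_add_right: "bracket x (y + z) = bracket x y + bracket x z"
    and bracket_scale_left: "bracket (scale c x) y = scale c (bracket x y)"
    and bracket_scale_right: "bracket x (scale c y) = scale c (bracket x y)"
    and bracket_self: "bracket x x = 0"
    and jacobi: "bracket x (bracket y z) + bracket y (bracket z x) + bracket z (bracket x y) = 0"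
begin

definition bracket_span :: "'b set \<Rightarrow> 'b set \<Rightarrow> 'b set" where
  "bracket_span A B = span {bracket x y | x y. x \<in> A \<and> y \<in> B}"

definition subalgebra :: "'b set \<Rightarrow> bool" where
  "subalgebra S \<longleftrightarrow> subspace S \<and> (\<forall>x\<in>S. \<forall>y\<in>S. bracket x y \<in> S)"

definition ideal_of :: "'b set \<Rightarrow> 'b set \<Rightarrow> bool" where
  "ideal_of P I \<longleftrightarrow> subspace I \<and> I \<subseteq> P \<and> (\<forall>x\<in>P. \<forall>y\<in>I. bracket x y \<in> I)"

definition abelian :: "'b set \<Rightarrow> bool" where
  "abelian S \<longleftrightarrow> (\<forall>x\<in>S. \<forall>y\<in>S. bracket x y = 0)"

definition centralizer :: "'b set \<Rightarrow> 'b set" where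
  "centralizer A = {x. \<forall>y\<in>A. bracket x y = 0}"

definition solvable :: "'b set \<Rightarrow> bool" where
  "solvable S \<longleftrightarrow> (\<exists>n::nat. ((\<lambda>T. bracket_span T T) ^^ n) S = {0})"

definition borel_subalgebra :: "'b set \<Rightarrow> bool" where
  "borel_subalgebra B \<longleftrightarrow> subalgebra B \<and> solvable B \<and>
     (\<forall>C. subalgebra C \<and> solvable C \<and> B \<subseteq> C \<longrightarrow> C = B)"

definition parabolic :: "'b set \<Rightarrow> bool" where
  "parabolic P \<longleftrightarrow> subalgebra P \<and> (\<exists>B. borel_subalgebra B \<and> B \<subseteq> P)"

definition nilpotent_element :: "'b \<Rightarrow> bool" where
  "nilpotent_element x \<longleftrightarrow>
     x \<in> bracket_span UNIV UNIV \<and> (\<exists>n::nat. (bracket x ^^ n) = (\<lambda>_. 0))"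

text \<open>Nilpotency refers to the ambient Lie algebra, not to \<open>P\<close>.\<close>

definition nil_ideal_of :: "'b set \<Rightarrow> 'b set \<Rightarrow> bool" where
  "nil_ideal_of P I \<longleftrightarrow> ideal_of P I \<and> (\<forall>x\<in>I. nilpotent_element x)"

text \<open>In finite dimension the maximal element is unique: by Engel's theorem the sum of two
  such ideals of a subalgebra \<open>P\<close> is again one.\<close>

definition nil_radical :: "'b set \<Rightarrow> 'b set" where
  "nil_radical P = (THE N. nil_ideal_of P N \<and> (\<forall>I. nil_ideal_of P I \<and> N \<subseteq> I \<longrightarrow> I = N))"

end

definition invariant_inner_product ::
    "('a::real_vector \<Rightarrow> 'a \<Rightarrow> 'a) \<Rightarrow> ('a \<Rightarrow> 'a \<Rightarrow> real) \<Rightarrow> bool" where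
  "invariant_inner_product br ip \<longleftrightarrow>
     bilinear ip \<and> (\<forall>x y. ip x y = ip y x) \<and> (\<forall>x. x \<noteq> 0 \<longrightarrow> ip x x > 0) \<and>
     (\<forall>x y z. ip (br x y) z + ip y (br x z) = 0)"


section \<open>Complexification\<close>

text \<open>The pair \<open>(x, y)\<close> stands for \<open>x + \<i> y\<close>; a vector \<open>x\<close> of the
  real space is identified with \<open>(x, 0)\<close>.\<close>

definition cscale :: "complex \<Rightarrow> 'a::real_vector \<times> 'a \<Rightarrow> 'a \<times> 'a" where
  "cscale c = (\<lambda>(x, y). (Re c *\<^sub>R x - Im c *\<^sub>R y, Re c *\<^sub>R y + Im c *\<^sub>R x))"

definition cbracket ::
    "('a::real_vector \<Rightarrow> 'a \<Rightarrow> 'a) \<Rightarrow> 'a \<times> 'a \<Rightarrow> 'a \<times> 'a \<Rightarrow> 'a \<times> 'a" where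
  "cbracket br = (\<lambda>(x, y) (x', y'). (br x x' - br y y', br x y' + br y x'))"

definition real_points :: "('a::real_vector \<times> 'a) set \<Rightarrow> 'a set" where
  "real_points P = {x. (x, 0) \<in> P}"

lemma vector_space_cscale: "vector_space (cscale :: complex \<Rightarrow> 'a::real_vector \<times> 'a \<Rightarrow> _)"
  by unfold_locales (auto simp: cscale_def algebra_simps)

lemma lie_algebra_complexification:
  fixes br :: "'a::real_vector \<Rightarrow> 'a \<Rightarrow> 'a"
  assumes "lie_algebra (*\<^sub>R) br"
  shows "lie_algebra cscale (cbracket br)"
proof -
  interpret L: lie_algebra "(*\<^sub>R)" br by fact
  interpret C: vector_space "cscale :: complex \<Rightarrow> 'a \<times> 'a \<Rightarrow> _" by (rule vector_space_cscale)
  have anti: "br x y = - br y x" for x y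
  proof -
    have "br (x + y) (x + y) = br x x + br x y + (br y x + br y y)"
      by (simp only: L.bracket_add_left L.bracket_add_right ac_simps)
    then have "br x y + br y x = 0"
      by (simp add: L.bracket_self)
    then show ?thesis by (simp add: eq_neg_iff_add_eq_0)
  qed
  have zero: "br 0 x = 0" "br x 0 = 0" for x
    using L.bracket_scale_left[of 0 0 x] L.bracket_scale_right[of x 0 0] by simp_all
  have minus: "br (- x) y = - br x y" "br x (- y) = - br x y" for x y
    using L.bracket_scale_left[of "-1" x y] L.bracket_scale_right[of x "-1" y] by simp_all
  have diff: "br (x - y) z = br x z - br y z" "br z (x - y) = br z x - br z y" for x y z
    using L.bracket_add_left[of x "- y" z] L.bracket_add_right[of z x "- y"]
    by (simp_all add: minus)
  note lin = L.bracket_add_left L.bracket_add_right L.bracket_scale_left L.bracket_scale_right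
    diff minus zero
  have jac: "br z (br x y) = - br x (br y z) - br y (br z x)" for x y z
    using L.jacobi[of x y z] by (simp add: algebra_simps eq_neg_iff_add_eq_0)
  show ?thesis
  proof unfold_locales
    fix x y z :: "'a \<times> 'a" and c :: complex
    obtain x1 x2 y1 y2 z1 z2 where [simp]: "x = (x1, x2)" "y = (y1, y2)" "z = (z1, z2)"
      by (cases x, cases y, cases z) auto
    show "cbracket br (x + y) z = cbracket br x z + cbracket br y z"
      "cbracket br x (y + z) = cbracket br x y + cbracket br x z"
      by (simp_all add: cbracket_def lin)
    show "cbracket br (cscale c x) y = cscale c (cbracket br x y)"
      "cbracket br x (cscale c y) = cscale c (cbracket br x y)"
      by (simp_all add: cbracket_def cscale_def lin algebra_simps)
    show "cbracket br x x = 0"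
      using anti[of x1 x2] by (simp add: cbracket_def L.bracket_self zero_prod_def)
    show "cbracket br x (cbracket br y z) + cbracket br y (cbracket br z x)
        + cbracket br z (cbracket br x y) = 0"
      by (simp add: cbracket_def lin zero_prod_def jac[of z1 x1 y1] jac[of z1 x1 y2]
          jac[of z1 x2 y1] jac[of z1 x2 y2] jac[of z2 x1 y1] jac[of z2 x1 y2] jac[of z2 x2 y1]
          jac[of z2 x2 y2])
  qed
qed


section \<open>Quotients by a subspace\<close>

text \<open>Elements of a quotient are cosets, which are added by the elementwise sum of sets from
  \<^theory>\<open>HOL-Library.Set_Algebras\<close>; the zero vector of the quotient is \<open>h\<close> itself.\<close>

definition proj :: "'a::real_vector set \<Rightarrow> 'a \<Rightarrow> 'a set" where
  "proj h x = x +o h"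

definition quot :: "'a::real_vector set \<Rightarrow> 'a set \<Rightarrow> 'a set set" where
  "quot m h = proj h ` m"

text \<open>The map on cosets induced by a linear map \<open>f\<close> preserving \<open>h\<close>, i.e. it sends
  \<open>proj h x\<close> to \<open>proj h (f x)\<close>. Adding \<open>h\<close> makes the result a full coset, e.g. when
  \<open>f = 0\<close>.\<close>

definition induced :: "'a::real_vector set \<Rightarrow> ('a \<Rightarrow> 'a) \<Rightarrow> 'a set \<Rightarrow> 'a set" where
  "induced h f u = f ` u + h"

lemma induced_proj:
  assumes "subspace h" "linear f" "f ` h \<subseteq> h"
  shows "induced h f (proj h x) = proj h (f x)"
proof (rule set_eqI, rule iffI)
  fix w assume "w \<in> induced h f (proj h x)"
  then obtain y z where "y \<in> h" "z \<in> h" "w = f (x + y) + z"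
    by (auto simp: induced_def proj_def elt_set_plus_def set_plus_def)
  then have "w = f x + (f y + z)" "f y + z \<in> h"
    using assms by (auto simp: linear_add add.assoc intro: subspace_add)
  then show "w \<in> proj h (f x)"
    by (auto simp: proj_def elt_set_plus_def)
next
  fix w assume "w \<in> proj h (f x)"
  then obtain z where z: "z \<in> h" "w = f x + z"
    by (auto simp: proj_def elt_set_plus_def)
  have "x \<in> proj h x"
    using subspace_0[OF assms(1)] by (auto simp: proj_def elt_set_plus_def)
  with z show "w \<in> induced h f (proj h x)"
    by (auto simp: induced_def set_plus_def)
qed

abbreviation qscale :: "'a::real_vector set \<Rightarrow> real \<Rightarrow> 'a set \<Rightarrow> 'a set" where
  "qscale h r \<equiv> induced h ((*\<^sub>R) r)"

abbreviation quminus :: "'a::real_vector set \<Rightarrow> 'a set \<Rightarrow> 'a set" where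
  "quminus h \<equiv> induced h uminus"

text \<open>\<open>X\<close> is a set of vectors whose images in the quotient of the whole space by
  \<open>h\<close> are pairwise different and form a basis there.\<close>

definition quot_basis :: "'a::real_vector set \<Rightarrow> 'a set \<Rightarrow> bool" where
  "quot_basis h X \<longleftrightarrow> finite X \<and>
     (\<forall>u \<in> quot UNIV h. \<exists>!c. c \<in> X \<rightarrow>\<^sub>E (UNIV :: real set) \<and> u = proj h (\<Sum>b\<in>X. c b *\<^sub>R b))"

definition quot_dim :: "'a::real_vector set \<Rightarrow> nat" where
  "quot_dim h = card (SOME X. quot_basis h X)"


section \<open>Complex structures on quotients\<close>

text \<open>A complex structure is normalized to be \<open>undefined\<close> outside its domain, so that
  equality of functions is equality of complex structures.\<close>

definition complex_structure ::
    "'a::real_vector set \<Rightarrow> 'a set \<Rightarrow> ('a set \<Rightarrow> 'a set) \<Rightarrow> bool" where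
  "complex_structure m h J \<longleftrightarrow>
     J \<in> quot m h \<rightarrow>\<^sub>E quot m h \<and>
     (\<forall>u\<in>quot m h. \<forall>v\<in>quot m h. J (u + v) = J u + J v) \<and>
     (\<forall>r. \<forall>u\<in>quot m h. J (qscale h r u) = qscale h r (J u)) \<and>
     (\<forall>u\<in>quot m h. J (J u) = quminus h u)"

definition ad_invariant ::
    "('a::real_vector \<Rightarrow> 'a \<Rightarrow> 'a) \<Rightarrow> 'a set \<Rightarrow> ('a set \<Rightarrow> 'a set) \<Rightarrow> bool" where
  "ad_invariant br h J \<longleftrightarrow>
     (\<forall>x\<in>h. \<forall>u\<in>quot UNIV h. J (induced h (br x) u) = induced h (br x) (J u))"

definition integrable_structure ::
    "('a::real_vector \<Rightarrow> 'a \<Rightarrow> 'a) \<Rightarrow> 'a set \<Rightarrow> ('a set \<Rightarrow> 'a set) \<Rightarrow> bool" where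
  "integrable_structure br h J \<longleftrightarrow>
     (\<forall>x y x' y'. proj h x' = J (proj h x) \<and> proj h y' = J (proj h y) \<longrightarrow>
        proj h (br x y) + J (proj h (br x' y) + proj h (br x y')) + quminus h (proj h (br x' y'))
          = proj h 0)"

text \<open>The \<open>\<i>\<close>-eigenspace of the complexification of \<open>J\<close>, inside the complexified
  quotient of \<open>m\<close> by \<open>h\<close>, whose elements are pairs of cosets. The equation says
  \<open>J (u + \<i> v) = \<i> (u + \<i> v)\<close>.\<close>

definition plus_eigenspace ::
    "'a::real_vector set \<Rightarrow> 'a set \<Rightarrow> ('a set \<Rightarrow> 'a set) \<Rightarrow> ('a set \<times> 'a set) set" where
  "plus_eigenspace m h J =
     {(u, v). u \<in> quot m h \<and> v \<in> quot m h \<and> (J u, J v) = (quminus h v, u)}"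

definition cproj :: "'a::real_vector set \<Rightarrow> 'a \<times> 'a \<Rightarrow> 'a set \<times> 'a set" where
  "cproj h = map_prod (proj h) (proj h)"

definition direct_sum_of :: "'b::monoid_add set \<Rightarrow> 'b set \<Rightarrow> 'b set \<Rightarrow> bool" where
  "direct_sum_of S A B \<longleftrightarrow> S = A + B \<and> A \<inter> B = {0}"

definition parabolic_structure ::
    "('a::real_vector \<Rightarrow> 'a \<Rightarrow> 'a) \<Rightarrow> 'a set \<Rightarrow> ('a \<times> 'a) set \<Rightarrow> ('a set \<Rightarrow> 'a set)
      \<Rightarrow> ('a set \<Rightarrow> 'a set)" where
  "parabolic_structure br h P J\<^sub>1 =
     (THE J. complex_structure UNIV h J \<and>
        direct_sum_of (cproj h -` plus_eigenspace UNIV h J)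
          (cproj h -` plus_eigenspace (real_points P) h J\<^sub>1)
          (lie_algebra.nil_radical cscale (cbracket br) P))"

end

theory Submission
  imports Defs "HOL-Computational_Algebra.Fundamental_Theorem_Algebra"
begin

text \<open>
Write \<open>g\<close> for the real Lie algebra, \<open>g\<^sub>C\<close> for its complexification and \<open>q\<close> for the preimage in
\<open>g\<^sub>C\<close> of the \<open>\<i>\<close>-eigenspace of \<open>J\<close>. Integrability makes \<open>q\<close> a complex subalgebra, and
\<open>q + conj q = g\<^sub>C\<close>, \<open>q \<inter> conj q = h\<^sub>C\<close>; moreover \<open>q\<close> determines \<open>J\<close>. The task is to find a
parabolic \<open>p\<close> with nil-radical \<open>n\<close> such that \<open>q\<close> is the direct sum of \<open>n\<close> and of its part in the
complexification of \<open>m = p \<inter> g\<close>; then \<open>J\<^sub>1\<close> is the restriction of \<open>J\<close> to \<open>m/h\<close>.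

The invariant inner product extends to a Hermitian form on \<open>g\<^sub>C\<close> for which \<open>ad x\<close> and
\<open>- ad (conj x)\<close> are adjoint. The trace of the compression of \<open>ad x\<close> to \<open>q\<close> is a linear
functional of \<open>x\<close>, represented by an element \<open>w\<close>. It satisfies \<open>conj w = - w\<close>, hence \<open>ad w\<close> is
self-adjoint. Geometrically \<open>w\<close> is, up to a constant factor, the value at the point \<open>q\<close> of the
moment map on the Grassmannian of \<open>g\<^sub>C\<close>. Two trace computations carry the proof.

First (\<open>form_trace_element\<close>), for \<open>x \<in> q\<close> the number \<open>\<langle>[w, x], x\<rangle>\<close> is the squared norm of the block
of \<open>ad x\<close> that maps the orthogonal complement of \<open>q\<close> into \<open>q\<close>. It is nonnegative, and if it
vanishes then \<open>ad (conj x)\<close>, which is up to sign the adjoint of \<open>ad x\<close>, preserves \<open>q\<close>.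

Second (\<open>trace_element_normalizes\<close>), \<open>w\<close> normalizes \<open>q\<close>. Because \<open>q + conj q = g\<^sub>C\<close>, the element
\<open>w\<close> is congruent modulo \<open>q\<close> to a real element \<open>r\<close>, so moving \<open>q\<close> in the direction \<open>w\<close> amounts to
moving it by an infinitesimal isometry, along which the length of the moment map is constant. In
formulas, the trace of the compression of \<open>[ad w, ad r]\<close> to \<open>q\<close> is \<open>\<langle>[w, r], w\<rangle> = 0\<close>, and it is also
twice the squared norm of the block of \<open>ad w\<close> that leads out of \<open>q\<close>.

By the spectral theorem the eigenspaces of \<open>ad w\<close> grade \<open>g\<^sub>C\<close> by real degrees, and conjugation
reverses degrees. Let \<open>p\<close> be the sum of the degrees \<open>\<ge> 0\<close> and \<open>n\<close> the sum of the degrees \<open>> 0\<close>. By the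
first computation \<open>q \<subseteq> p\<close>, and then \<open>q + conj q = g\<^sub>C\<close> forces \<open>n \<subseteq> q\<close>. The part of degree zero is
\<open>m\<^sub>C\<close>; the case of equality in the first computation shows that it normalizes \<open>q\<close>. Hence
\<open>h\<^sub>C\<close> is an ideal of \<open>m\<^sub>C\<close>, and \<open>m/h\<close> is a compact Lie algebra whose complexification is the sum of
two commuting conjugate ideals, which makes it abelian and gives \<open>[m, m] = [h, h]\<close>
(\<open>parabolic_of_transversal\<close>).

That \<open>p\<close> is parabolic with nil-radical \<open>n\<close> follows from two more uses of compactness. A
conjugation-stable solvable subalgebra is abelian (\<open>conj_stable_solvable_abelian\<close>), which
confines to \<open>p\<close> every solvable subalgebra containing \<open>w\<close> and \<open>n\<close>. A nilpotent element commuting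
with its conjugate is zero (\<open>normal_nilpotent_eq_0\<close>), which kills the degree-zero components of the
elements of a nil ideal of \<open>p\<close>.
\<close>

section \<open>Finite-dimensional Hermitian spaces\<close>

locale hermitian_space = vector_space scale
  for scale :: "complex \<Rightarrow> 'b::ab_group_add \<Rightarrow> 'b" (infixr "*c" 75) +
  fixes form :: "'b \<Rightarrow> 'b \<Rightarrow> complex"
  assumes finite_spanning: "\<exists>S. finite S \<and> span S = UNIV"
    and form_add_left: "form (x + y) z = form x z + form y z"
    and form_scale_left: "form (c *c x) y = c * form x y"
    and form_cnj: "cnj (form x y) = form y x"
    and form_pos: "x \<noteq> 0 \<Longrightarrow> Re (form x x) > 0"
begin

lemma form_add_right: "form x (y + z) = form x y + form x z"
  using form_add_left[of y z x] by (metis form_cnj complex_cnj_add)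

lemma form_scale_right: "form x (c *c y) = cnj c * form x y"
  using form_scale_left[of c y x] by (metis form_cnj complex_cnj_mult)

lemma form_zero_left [simp]: "form 0 x = 0"
  using form_scale_left[of 0 0 x] by simp

lemma form_zero_right [simp]: "form x 0 = 0"
  using form_scale_right[of x 0 0] by simp

lemma form_minus_left: "form (- x) y = - form x y"
  using form_add_left[of x "- x" y] by (simp add: eq_neg_iff_add_eq_0 add.commute)

lemma form_minus_right: "form x (- y) = - form x y"
  using form_add_right[of x y "- y"] by (simp add: eq_neg_iff_add_eq_0 add.commute)

lemma form_diff_left: "form (x - y) z = form x z - form y z"
  using form_add_left[of x "- y" z] by (simp add: form_minus_left)

lemma form_sum_left: "form (\<Sum>i\<in>A. f i) x = (\<Sum>i\<in>A. form (f i) x)"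
  by (induction A rule: infinite_finite_induct) (auto simp: form_add_left)

lemma form_sum_right: "form x (\<Sum>i\<in>A. f i) = (\<Sum>i\<in>A. form x (f i))"
  by (induction A rule: infinite_finite_induct) (auto simp: form_add_right)

lemma form_self: "form x x = of_real (Re (form x x))"
  using form_cnj[of x x] by (simp add: complex_eq_iff)

lemma form_self_eq_0 [simp]: "form x x = 0 \<longleftrightarrow> x = 0"
  by (metis form_pos form_zero_left less_irrefl zero_complex.simps(1))

lemma form_eq_0_sym: "form x y = 0 \<longleftrightarrow> form y x = 0"
  by (metis form_cnj complex_cnj_zero)

lemma form_eqI: "(\<And>y. form x y = form x' y) \<Longrightarrow> x = x'"
  using form_self_eq_0[of "x - x'"] by (simp add: form_diff_left)

lemma subspace_form_kernel: "subspace {x. form x y = 0}" "subspace {x. form y x = 0}"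
  by (auto intro!: subspaceI simp: form_add_left form_add_right form_scale_left form_scale_right)

lemma form_span_eq_0:
  assumes "\<And>x y. x \<in> A \<Longrightarrow> y \<in> B \<Longrightarrow> form x y = 0" "x \<in> span A" "y \<in> span B"
  shows "form x y = 0"
proof -
  have "form x' y = 0" if "x' \<in> A" for x'
    using span_minimal[OF _ subspace_form_kernel(2)[of x'], of B] assms(1,3) that by blast
  then show ?thesis
    using span_minimal[OF _ subspace_form_kernel(1)[of y], of A] assms(2) by blast
qed

definition perp :: "'b set \<Rightarrow> 'b set" where
  "perp V = {x. \<forall>y\<in>V. form x y = 0}"

lemma subspace_perp: "subspace (perp V)"
  by (auto intro!: subspaceI simp: perp_def form_add_left form_scale_left)

definition orthonormal :: "'b set \<Rightarrow> bool" where
  "orthonormal E \<longleftrightarrow> (\<forall>e\<in>E. \<forall>f\<in>E. form e f = (if e = f then 1 else 0))"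

definition orthonormal_basis :: "'b set \<Rightarrow> 'b set \<Rightarrow> bool" where
  "orthonormal_basis V E \<longleftrightarrow> orthonormal E \<and> span E = V"

lemma orthonormal_coordinate:
  assumes "orthonormal E" "finite A" "A \<subseteq> E" "e \<in> E"
  shows "form (\<Sum>f\<in>A. c f *c f) e = (if e \<in> A then c e else 0)"
proof -
  have "form (\<Sum>f\<in>A. c f *c f) e = (\<Sum>f\<in>A. if f = e then c f else 0)"
    unfolding form_sum_left
    by (rule sum.cong) (use assms in \<open>auto simp: form_scale_left orthonormal_def\<close>)
  then show ?thesis
    using assms(2) by simp
qed

lemma orthonormal_independent:
  assumes "orthonormal E"
  shows "independent E"
proof
  assume "dependent E"
  then obtain A c v where A: "finite A" "A \<subseteq> E" "(\<Sum>f\<in>A. c f *c f) = 0" "v \<in> A" "c v \<noteq> 0"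
    unfolding dependent_explicit by blast
  then show False
    using orthonormal_coordinate[OF assms A(1,2), of v c] by auto
qed

lemma orthonormal_card_bound: "\<exists>N. \<forall>E. orthonormal E \<longrightarrow> finite E \<and> card E \<le> N"
proof -
  obtain S where "finite S" "span S = UNIV"
    using finite_spanning by blast
  then show ?thesis
    using independent_span_bound[of S] orthonormal_independent by auto
qed

lemma orthonormal_finite: "orthonormal E \<Longrightarrow> finite E"
  using orthonormal_card_bound by blast

lemma orthonormal_expansion:
  assumes "orthonormal E" "x \<in> span E"
  shows "x = (\<Sum>e\<in>E. form x e *c e)"
proof -
  have fin: "finite E"
    using assms orthonormal_finite by blast
  then obtain c where c: "x = (\<Sum>e\<in>E. c e *c e)"
    using assms(2) span_finite by auto
  have "form x e = c e" if "e \<in> E" for e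
    unfolding c using orthonormal_coordinate[OF assms(1) fin order_refl that] that by simp
  then show ?thesis
    using c by (metis (no_types, lifting) sum.cong)
qed

lemma projection_perp:
  assumes "orthonormal E"
  shows "x - (\<Sum>e\<in>E. form x e *c e) \<in> perp (span E)"
proof -
  have *: "form (x - (\<Sum>e\<in>E. form x e *c e)) f = 0" if "f \<in> E" for f
    using orthonormal_coordinate[OF assms orthonormal_finite[OF assms] order_refl that] that
    by (simp add: form_diff_left)
  have "E \<subseteq> {y. form (x - (\<Sum>e\<in>E. form x e *c e)) y = 0}"
    using * by blast
  then have "span E \<subseteq> {y. form (x - (\<Sum>e\<in>E. form x e *c e)) y = 0}"
    using subspace_form_kernel(2) by (rule span_minimal)
  then show ?thesis
    by (auto simp: perp_def)
qed

lemma perp_decomposition: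
  assumes "orthonormal_basis V E"
  obtains y z where "x = y + z" "y \<in> V" "z \<in> perp V"
proof
  show "x = (\<Sum>e\<in>E. form x e *c e) + (x - (\<Sum>e\<in>E. form x e *c e))" by simp
  show "(\<Sum>e\<in>E. form x e *c e) \<in> V"
    using assms span_base
    by (auto simp: orthonormal_basis_def intro!: subspace_sum subspace_scale)
  show "x - (\<Sum>e\<in>E. form x e *c e) \<in> perp V"
    using assms projection_perp by (auto simp: orthonormal_basis_def)
qed

lemma parseval:
  assumes "orthonormal_basis UNIV E"
  shows "form x y = (\<Sum>e\<in>E. form x e * cnj (form y e))"
proof -
  have "x = (\<Sum>e\<in>E. form x e *c e)"
    using assms orthonormal_expansion by (auto simp: orthonormal_basis_def)
  then have "form x y = (\<Sum>e\<in>E. form (form x e *c e) y)"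
    by (metis form_sum_left)
  then show ?thesis
    by (simp add: form_scale_left form_cnj)
qed

text \<open>The representing vector is written out in the basis, so that a functional defined by a trace
  yields an explicit element of the Lie algebra.\<close>

lemma functional_representation:
  assumes add: "\<And>x y. f (x + y) = f x + f y" and scale: "\<And>c x. f (c *c x) = c * f x"
    and E: "orthonormal_basis UNIV E"
  shows "f x = form x (\<Sum>e\<in>E. cnj (f e) *c e)"
proof -
  have f0: "f 0 = 0"
    using scale[of 0 0] by simp
  have fsum: "f (\<Sum>e\<in>A. g e) = (\<Sum>e\<in>A. f (g e))" for A :: "'b set" and g
    by (induction A rule: infinite_finite_induct) (auto simp: add f0)
  have "x = (\<Sum>e\<in>E. form x e *c e)"
    using E orthonormal_expansion by (auto simp: orthonormal_basis_def)
  then have "f x = (\<Sum>e\<in>E. form x e * f e)"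
    by (metis (mono_tags, lifting) fsum scale sum.cong)
  then show ?thesis
    by (simp add: form_sum_right form_scale_right mult.commute)
qed

text \<open>Evaluation of a polynomial at the operator \<open>T\<close>, applied to \<open>v\<close>.\<close>

definition poly_apply :: "('b \<Rightarrow> 'b) \<Rightarrow> 'b \<Rightarrow> complex poly \<Rightarrow> 'b" where
  "poly_apply T v p = fold_coeffs (\<lambda>a u. a *c v + T u) p 0"

context
  fixes T :: "'b \<Rightarrow> 'b"
  assumes T_add: "T (x + y) = T x + T y" and T_scale: "T (c *c x) = c *c T x"
begin

lemma T_zero: "T 0 = 0"
  using T_scale[of 0 0] by simp

lemma poly_apply_0 [simp]: "poly_apply T v 0 = 0"
  by (simp add: poly_apply_def)

lemma poly_apply_pCons [simp]: "poly_apply T v (pCons a p) = a *c v + T (poly_apply T v p)"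
  by (cases "p = 0 \<and> a = 0") (auto simp: poly_apply_def T_zero)

lemma poly_apply_add: "poly_apply T v (p + r) = poly_apply T v p + poly_apply T v r"
  by (induction p r rule: poly_induct2) (auto simp: T_add scale_left_distrib algebra_simps)

lemma poly_apply_smult: "poly_apply T v (smult c p) = c *c poly_apply T v p"
  by (induction p) (auto simp: T_add T_scale scale_right_distrib)

lemma poly_apply_monom: "poly_apply T v (monom a n) = a *c (T ^^ n) v"
  by (induction n) (auto simp: monom_0 monom_Suc T_zero T_scale)

lemma poly_apply_sum: "poly_apply T v (\<Sum>i\<in>A. g i) = (\<Sum>i\<in>A. poly_apply T v (g i))"
  by (induction A rule: infinite_finite_induct) (auto simp: poly_apply_add)

lemma poly_apply_linear_factor:
  "poly_apply T v ([:- z, 1:] * p) = T (poly_apply T v p) - z *c poly_apply T v p"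
proof -
  have "[:- z, 1:] * p = pCons 0 p + smult (- z) p"
    by simp
  then show ?thesis
    by (simp only: poly_apply_add poly_apply_smult) simp
qed

lemma poly_apply_invariant:
  assumes "subspace V" "T ` V \<subseteq> V" "v \<in> V"
  shows "poly_apply T v p \<in> V"
  using assms by (induction p) (auto intro!: subspace_add subspace_scale subspace_0)

text \<open>The iterates \<open>T\<^sup>i v\<close> cannot be independent: either two of them coincide, or finitely many
  distinct ones satisfy a linear relation, whose coefficients form the polynomial.\<close>

lemma annihilating_polynomial: "\<exists>p. p \<noteq> 0 \<and> poly_apply T v p = 0"
proof -
  obtain S where S: "finite S" "span S = UNIV"
    using finite_spanning by blast
  define f where "f i = (T ^^ i) v" for i
  show ?thesis
  proof (cases "inj f")
    case False
    then obtain i j where ij: "i \<noteq> j" "f i = f j"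
      by (auto simp: inj_def)
    have "coeff (monom 1 i + monom (- 1) j) i \<noteq> (0::complex)"
      using ij by simp
    then have "monom 1 i + monom (- 1) j \<noteq> (0 :: complex poly)"
      by (metis coeff_0)
    moreover have "poly_apply T v (monom 1 i + monom (- 1) j) = 0"
      using ij by (simp add: poly_apply_add poly_apply_monom f_def)
    ultimately show ?thesis
      by blast
  next
    case True
    let ?A = "f ` {..card S}"
    have "card ?A = Suc (card S)"
      using True by (simp add: card_image inj_on_subset)
    then have "dependent ?A"
      using independent_span_bound[OF S(1), of ?A] S(2) by fastforce
    then obtain c w where c: "(\<Sum>u\<in>?A. c u *c u) = 0" "w \<in> ?A" "c w \<noteq> 0"
      using dependent_finite[of ?A] by auto
    let ?p = "\<Sum>i\<le>card S. monom (c (f i)) i"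
    obtain k where k: "k \<le> card S" "w = f k"
      using c(2) by blast
    have "coeff ?p k = (\<Sum>i\<le>card S. if k = i then c (f i) else 0)"
      by (simp add: coeff_sum)
    then have "coeff ?p k \<noteq> 0"
      using k c(3) by simp
    then have "?p \<noteq> 0"
      by (metis coeff_0)
    moreover have "poly_apply T v ?p = (\<Sum>u\<in>?A. c u *c u)"
      using inj_on_subset[OF True, of "{..card S}"]
      by (simp add: poly_apply_sum poly_apply_monom sum.reindex flip: f_def)
    ultimately show ?thesis
      using c(1) by metis
  qed
qed

text \<open>Split off linear factors \<open>X - z\<close> of a polynomial \<open>p\<close> annihilating \<open>v\<close>, one root at a time:
  when the cofactor \<open>r\<close> no longer annihilates \<open>v\<close>, the vector \<open>r(T) v\<close> is an eigenvector.\<close>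

lemma eigenvector_exists:
  assumes V: "subspace V" "T ` V \<subseteq> V" and v: "v \<in> V" "v \<noteq> 0"
  shows "\<exists>z u. u \<in> V \<and> u \<noteq> 0 \<and> T u = z *c u"
proof -
  have "\<exists>z u. u \<in> V \<and> u \<noteq> 0 \<and> T u = z *c u" if "p \<noteq> 0" "poly_apply T v p = 0" for p
    using that
  proof (induction "degree p" arbitrary: p rule: less_induct)
    case less
    show ?case
    proof (cases "degree p = 0")
      case True
      then obtain a where "p = [:a:]"
        using degree_eq_zeroE by blast
      then show ?thesis
        using less.prems v by (auto simp: T_zero)
    next
      case False
      then have "\<not> constant (poly p)"
        by (simp add: constant_degree)
      then obtain z where "poly p z = 0"
        using fundamental_theorem_of_algebra by blast
      then obtain r where r: "p = [:- z, 1:] * r"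
        by (auto simp: poly_eq_0_iff_dvd)
      then have "r \<noteq> 0"
        using less.prems(1) by auto
      then have "degree r < degree p"
        by (simp add: r degree_mult_eq del: mult_pCons_left)
      show ?thesis
      proof (cases "poly_apply T v r = 0")
        case True
        then show ?thesis
          using less.hyps \<open>degree r < degree p\<close> \<open>r \<noteq> 0\<close> by blast
      next
        case False
        have "T (poly_apply T v r) = z *c poly_apply T v r"
          using less.prems(2) unfolding r poly_apply_linear_factor by simp
        then show ?thesis
          using False poly_apply_invariant[OF V v(1)] by blast
      qed
    qed
  qed
  moreover obtain p where "p \<noteq> 0" "poly_apply T v p = 0"
    using annihilating_polynomial by blast
  ultimately show ?thesis
    by metis
qed

text \<open>Take a largest orthonormal set of eigenvectors in \<open>V\<close>. Its orthogonal complement in \<open>V\<close> is again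
  \<open>T\<close>-invariant, so a nonzero complement would contain one more eigenvector.\<close>

theorem spectral_theorem:
  assumes self_adjoint: "\<And>x y. form (T x) y = form x (T y)"
    and V: "subspace V" "T ` V \<subseteq> V"
  shows "\<exists>E. orthonormal_basis V E \<and> (\<forall>e\<in>E. \<exists>l::real. T e = of_real l *c e)"
proof -
  define good where
    "good E \<longleftrightarrow> orthonormal E \<and> E \<subseteq> V \<and> (\<forall>e\<in>E. \<exists>l::real. T e = of_real l *c e)" for E
  obtain N where N: "\<And>E. orthonormal E \<Longrightarrow> finite E \<and> card E \<le> N"
    using orthonormal_card_bound by blast
  have "good {}"
    by (simp add: good_def orthonormal_def)
  moreover have "\<forall>E. good E \<longrightarrow> card E < Suc N"
    using N by (auto simp: good_def less_Suc_eq_le)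
  ultimately obtain E where E: "good E" and max: "\<And>E'. good E' \<Longrightarrow> card E' \<le> card E"
    using ex_has_greatest_nat[of good "{}" card "Suc N"] by metis
  have fin: "finite E"
    using E N by (auto simp: good_def)
  have "V \<inter> perp E = {0}"
  proof (rule ccontr)
    assume "V \<inter> perp E \<noteq> {0}"
    then obtain v where v: "v \<in> V \<inter> perp E" "v \<noteq> 0"
      using subspace_0[OF V(1)] by (auto simp: perp_def)
    have "form (T x) e = 0" if x: "x \<in> perp E" and e: "e \<in> E" for x e
    proof -
      obtain l :: real where "T e = of_real l *c e"
        using E e by (auto simp: good_def)
      then show ?thesis
        using x e by (simp add: self_adjoint form_scale_right perp_def)
    qed
    then have "T ` (V \<inter> perp E) \<subseteq> V \<inter> perp E"
      using V(2) by (auto simp: perp_def)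
    then obtain z u where u: "u \<in> V" "u \<in> perp E" "u \<noteq> 0" "T u = z *c u"
      using eigenvector_exists[OF subspace_inter[OF V(1) subspace_perp] _ v] by blast
    have "z * form u u = cnj z * form u u"
      using self_adjoint[of u u] u(4) by (simp add: form_scale_left form_scale_right)
    then have "z = cnj z"
      using u(3) by simp
    then have "z = of_real (Re z)"
      by (simp add: complex_eq_iff)
    define n where "n = sqrt (Re (form u u))"
    have n: "n > 0" "form u u = of_real (n ^ 2)"
      using form_pos[OF u(3)] form_self[of u] by (simp_all add: n_def)
    define e where "e = of_real (1 / n) *c u"
    have ee: "form e e = 1"
      using n by (simp add: e_def form_scale_left form_scale_right power2_eq_square)
    have perp: "form e f = 0" "form f e = 0" if "f \<in> E" for f
      using u(2) that form_eq_0_sym by (auto simp: e_def form_scale_left perp_def form_scale_right)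
    then have "e \<notin> E"
      using ee by auto
    have "T e = z *c e"
      using u(4) by (simp add: e_def T_scale mult.commute)
    moreover have "orthonormal (insert e E)"
      using E ee perp by (auto simp: good_def orthonormal_def)
    ultimately have "good (insert e E)"
      using E u(1) V(1) \<open>z = of_real (Re z)\<close>
      by (auto simp: good_def e_def subspace_scale)
    then show False
      using max[of "insert e E"] fin \<open>e \<notin> E\<close> by simp
  qed
  have "span E \<subseteq> V"
    using E V(1) span_minimal by (auto simp: good_def)
  moreover have "x \<in> span E" if "x \<in> V" for x
  proof -
    let ?y = "\<Sum>e\<in>E. form x e *c e"
    have y: "?y \<in> span E"
      by (intro span_sum span_scale span_base)
    have "x - ?y \<in> perp (span E)"
      using E projection_perp by (auto simp: good_def)
    then have "x - ?y \<in> V \<inter> perp E"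
      using that y \<open>span E \<subseteq> V\<close> V(1) span_base by (auto simp: perp_def subspace_diff)
    then show ?thesis
      using y \<open>V \<inter> perp E = {0}\<close> by auto
  qed
  ultimately show ?thesis
    using E by (auto simp: good_def orthonormal_basis_def)
qed

end

lemma orthonormal_basis_exists:
  assumes "subspace V"
  shows "\<exists>E. orthonormal_basis V E"
  using spectral_theorem[of "\<lambda>x. x" V] assms by auto

text \<open>Such bases split sums over the whole space into the blocks of an operator with respect to
  \<open>V\<close> and its complement.\<close>

lemma orthonormal_basis_Un_perp:
  assumes "orthonormal_basis V E" "orthonormal_basis (perp V) F"
  shows "orthonormal_basis UNIV (E \<union> F)" "E \<inter> F = {}"
proof -
  have sp: "span E = V" "span F = perp V"
    using assms by (auto simp: orthonormal_basis_def)
  then have EF: "form f e = 0" "form e f = 0" if "e \<in> E" "f \<in> F" for e f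
    using that span_base[of e E] span_base[of f F] form_eq_0_sym[of f e] by (auto simp: perp_def)
  have "orthonormal E" "orthonormal F"
    using assms by (auto simp: orthonormal_basis_def)
  show disj: "E \<inter> F = {}"
    using EF(1)[of e e for e] \<open>orthonormal E\<close> by (force simp: orthonormal_def)
  have "orthonormal (E \<union> F)"
    using \<open>orthonormal E\<close> \<open>orthonormal F\<close> EF disj by (auto simp: orthonormal_def)
  moreover have "x \<in> span (E \<union> F)" for x
  proof -
    obtain y z where "x = y + z" "y \<in> V" "z \<in> perp V"
      using perp_decomposition[OF assms(1)] by blast
    then show ?thesis
      using sp span_add[of y "E \<union> F" z] span_mono[of E "E \<union> F"] span_mono[of F "E \<union> F"] by auto
  qed
  ultimately show "orthonormal_basis UNIV (E \<union> F)"
    by (auto simp: orthonormal_basis_def)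
qed

end


section \<open>Complexifications of compact Lie algebras\<close>

text \<open>The axioms describe the complexification of a Lie algebra with an invariant inner product:
  \<open>conj\<close> is the conjugation fixing the real points, and invariance of the inner product says that
  \<open>ad a\<close> and \<open>- ad (conj a)\<close> are adjoint.\<close>

locale unitary_lie_algebra = hermitian_space scale form + lie_algebra scale bracket
  for scale :: "complex \<Rightarrow> 'b::ab_group_add \<Rightarrow> 'b" (infixr "*c" 75)
    and form :: "'b \<Rightarrow> 'b \<Rightarrow> complex"
    and bracket :: "'b \<Rightarrow> 'b \<Rightarrow> 'b" +
  fixes conj :: "'b \<Rightarrow> 'b"
  assumes conj_add: "conj (x + y) = conj x + conj y"
    and conj_scale: "conj (c *c x) = cnj c *c conj x"
    and conj_conj [simp]: "conj (conj x) = x"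
    and conj_bracket: "conj (bracket x y) = bracket (conj x) (conj y)"
    and form_conj: "form (conj x) (conj y) = cnj (form x y)"
    and form_bracket: "form (bracket a x) y = - form x (bracket (conj a) y)"
begin

lemma bracket_zero [simp]: "bracket 0 x = 0" "bracket x 0 = 0"
  using bracket_scale_left[of 0 0 x] bracket_scale_right[of x 0 0] by simp_all

lemma bracket_minus: "bracket (- x) y = - bracket x y" "bracket x (- y) = - bracket x y"
  using bracket_add_left[of x "- x" y] bracket_add_right[of x y "- y"]
  by (simp_all add: eq_neg_iff_add_eq_0 add.commute)

lemma bracket_diff: "bracket (x - y) z = bracket x z - bracket y z"
    "bracket x (y - z) = bracket x y - bracket x z"
  using bracket_add_left[of x "- y" z] bracket_add_right[of x y "- z"]
  by (simp_all add: bracket_minus)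

lemma bracket_anti: "bracket x y = - bracket y x"
proof -
  have "bracket (x + y) (x + y) = bracket x x + bracket x y + (bracket y x + bracket y y)"
    by (simp only: bracket_add_left bracket_add_right ac_simps)
  then have "bracket x y + bracket y x = 0"
    by (simp add: bracket_self)
  then show ?thesis
    by (simp add: eq_neg_iff_add_eq_0 add.commute)
qed

lemma bracket_derivation:
  "bracket a (bracket x y) = bracket (bracket a x) y + bracket x (bracket a y)"
proof -
  have "bracket x (bracket y a) = - bracket x (bracket a y)"
    by (metis bracket_anti bracket_minus(2))
  moreover have "bracket y (bracket a x) = - bracket (bracket a x) y"
    by (rule bracket_anti)
  ultimately show ?thesis
    using jacobi[of a x y] by (simp add: algebra_simps)
qed

lemma conj_zero [simp]: "conj 0 = 0"
  using conj_scale[of 0 0] by simp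

lemma conj_minus: "conj (- x) = - conj x"
  using conj_add[of x "- x"] by (simp add: eq_neg_iff_add_eq_0 add.commute)

lemma mem_conj_image: "x \<in> conj ` V \<longleftrightarrow> conj x \<in> V"
  by (metis conj_conj image_iff)

lemma subspace_conj_image: "subspace V \<Longrightarrow> subspace (conj ` V)"
  by (auto simp: subspace_def mem_conj_image conj_add conj_scale)

lemma conj_span: "x \<in> span A \<Longrightarrow> conj x \<in> span (conj ` A)"
  using span_minimal[OF _ subspace_conj_image[OF subspace_span], of A "conj ` A"] span_base
  by (fastforce simp: mem_conj_image)

lemma bracket_mem_span:
  assumes "\<And>x y. x \<in> A \<Longrightarrow> y \<in> B \<Longrightarrow> bracket x y \<in> V" "subspace V"
    and "x \<in> span A" "y \<in> span B"
  shows "bracket x y \<in> V"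
proof -
  have sub: "subspace {x. bracket x z \<in> V}" "subspace {x. bracket z x \<in> V}" for z
    using assms(2)
    by (auto simp: subspace_def bracket_add_left bracket_add_right bracket_scale_left
        bracket_scale_right)
  have "bracket x' y \<in> V" if "x' \<in> A" for x'
    using span_minimal[OF _ sub(2), of B x'] assms(1,4) that by blast
  then show ?thesis
    using span_minimal[OF _ sub(1), of A y] assms(3) by blast
qed

lemma bracket_span_minimal:
  assumes "\<And>x y. x \<in> A \<Longrightarrow> y \<in> B \<Longrightarrow> bracket x y \<in> V" "subspace V"
  shows "bracket_span A B \<subseteq> V"
  unfolding bracket_span_def using assms by (intro span_minimal) auto

lemma bracket_in_bracket_span: "x \<in> A \<Longrightarrow> y \<in> B \<Longrightarrow> bracket x y \<in> bracket_span A B"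
  unfolding bracket_span_def by (rule span_base) blast

lemma subspace_bracket_span: "subspace (bracket_span A B)"
  by (simp add: bracket_span_def)

lemma bracket_span_mono: "A \<subseteq> A' \<Longrightarrow> B \<subseteq> B' \<Longrightarrow> bracket_span A B \<subseteq> bracket_span A' B'"
  unfolding bracket_span_def by (rule span_mono) blast

abbreviation derived :: "'b set \<Rightarrow> 'b set" where
  "derived \<equiv> \<lambda>T. bracket_span T T"

lemma derived_funpow_mono: "A \<subseteq> B \<Longrightarrow> (derived ^^ n) A \<subseteq> (derived ^^ n) B"
  by (induction n) (auto simp: bracket_span_mono)

lemma zero_in_derived_funpow: "0 \<in> A \<Longrightarrow> 0 \<in> (derived ^^ n) A"
  by (induction n) (auto simp: subspace_0[OF subspace_bracket_span])

lemma solvable_subset: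
  assumes "solvable B" "A \<subseteq> B" "0 \<in> A"
  shows "solvable A"
proof -
  obtain n where "(derived ^^ n) B = {0}"
    using assms(1) by (auto simp: solvable_def)
  then have "(derived ^^ n) A = {0}"
    using derived_funpow_mono[OF assms(2), of n] zero_in_derived_funpow[OF assms(3), of n] by auto
  then show ?thesis
    by (auto simp: solvable_def)
qed

lemma derived_subset: "subalgebra T \<Longrightarrow> derived T \<subseteq> T"
  by (rule bracket_span_minimal) (auto simp: subalgebra_def)

lemma subalgebra_derived: "subalgebra T \<Longrightarrow> subalgebra (derived T)"
  using derived_subset[of T]
  by (auto simp: subalgebra_def[of "derived T"] subspace_bracket_span
      intro!: bracket_in_bracket_span)

text \<open>If \<open>T\<close> is conjugation-stable and its derived algebra \<open>D\<close> is abelian, then two applications of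
  the adjunction give \<open>D = 0\<close>: for \<open>z \<in> D\<close> and \<open>a \<in> T\<close> the squared norm of \<open>[a, z]\<close> equals
  \<open>\<langle>a, [conj z, [a, z]]\<rangle>\<close>, where the inner bracket is taken inside \<open>D\<close> and vanishes, so \<open>T\<close>
  commutes with \<open>D\<close>; and then the squared norm of \<open>[x, y]\<close> equals \<open>- \<langle>y, [conj x, [x, y]]\<rangle> = 0\<close>. Descending along the derived series, a solvable \<open>T\<close>
  is abelian.\<close>

lemma conj_stable_solvable_abelian:
  assumes "subalgebra T" "conj ` T \<subseteq> T" "solvable T" "x \<in> T" "y \<in> T"
  shows "bracket x y = 0"
proof -
  have "derived T = {0}" if "(derived ^^ n) T = {0}" "subalgebra T" "conj ` T \<subseteq> T" for n T
    using that
  proof (induction n arbitrary: T)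
    case 0
    then show ?case
      using derived_subset[of T] subspace_0[OF subspace_bracket_span, of T T] by auto
  next
    case (Suc n)
    let ?D = "derived T"
    have conjD: "conj z \<in> ?D" if "z \<in> ?D" for z
    proof -
      have "?D \<subseteq> conj ` ?D"
      proof (rule bracket_span_minimal)
        show "subspace (conj ` ?D)"
          by (intro subspace_conj_image subspace_bracket_span)
        fix x y assume "x \<in> T" "y \<in> T"
        then show "bracket x y \<in> conj ` ?D"
          using Suc.prems(3) by (auto simp: mem_conj_image conj_bracket intro!: bracket_in_bracket_span)
      qed
      then show ?thesis
        using that by (auto simp: mem_conj_image)
    qed
    have "(derived ^^ n) ?D = {0}"
      using Suc.prems(1) by (simp only: funpow_Suc_right o_apply)
    then have "derived ?D = {0}"
      by (rule Suc.IH[OF _ subalgebra_derived[OF Suc.prems(2)]]) (use conjD in auto)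
    then have abel: "bracket a b = 0" if "a \<in> ?D" "b \<in> ?D" for a b
      using bracket_in_bracket_span[OF that] by simp
    have ideal: "bracket a b \<in> ?D" if "a \<in> T" "b \<in> ?D" for a b
      using that derived_subset[OF Suc.prems(2)] bracket_in_bracket_span[of a T b T] by blast
    have central: "bracket a z = 0" if aT: "a \<in> T" and zD: "z \<in> ?D" for a z
    proof -
      have "form (bracket a z) (bracket a z) = - form (bracket z a) (bracket a z)"
        by (metis bracket_anti form_minus_left)
      also have "\<dots> = form a (bracket (conj z) (bracket a z))"
        by (simp add: form_bracket)
      also have "\<dots> = 0"
        using abel[OF conjD[OF zD] ideal[OF aT zD]] by simp
      finally show ?thesis
        by simp
    qed
    have "bracket x y = 0" if "x \<in> T" "y \<in> T" for x y
    proof -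
      have "conj x \<in> T"
        using that Suc.prems(3) by auto
      then have "form (bracket x y) (bracket x y) = 0"
        using central[of "conj x" "bracket x y"] bracket_in_bracket_span[OF that]
        by (simp add: form_bracket)
      then show ?thesis
        by simp
    qed
    then show ?case
      using bracket_span_minimal[of T T "{0}"] subspace_0[OF subspace_bracket_span, of T T] by auto
  qed
  then show ?thesis
    using assms bracket_in_bracket_span[OF assms(4,5)] unfolding solvable_def by auto
qed

text \<open>Here \<open>ad y\<close> is a normal operator, so the kernel of its square is its kernel, and nilpotency
  gives \<open>ad y = 0\<close>. A central element is orthogonal to all brackets, while nilpotent elements lie in
  the derived algebra.\<close>

lemma normal_nilpotent_eq_0:
  assumes comm: "bracket y (conj y) = 0" and nil: "nilpotent_element y"
  shows "y = 0"
proof -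
  have step: "bracket y x = 0" if "bracket y (bracket y x) = 0" for x
  proof -
    let ?u = "bracket y x"
    have "bracket y (bracket (conj y) ?u) = bracket (conj y) (bracket y ?u)"
      using bracket_derivation[of y "conj y" ?u] comm by simp
    then have "form (bracket (conj y) ?u) (bracket (conj y) ?u) = 0"
      using that by (simp add: form_bracket[of "conj y"])
    then have "bracket (conj y) ?u = 0"
      by simp
    then have "form ?u ?u = 0"
      using form_bracket[of y x ?u] by simp
    then show ?thesis
      by simp
  qed
  have "bracket y x = 0" if "(bracket y ^^ n) x = 0" for n x
    using that
  proof (induction n)
    case (Suc n)
    then show ?case
      using step by (cases n) auto
  qed simp
  then have central: "bracket y x = 0" for x
    using nil unfolding nilpotent_element_def by metis
  have "bracket_span UNIV UNIV \<subseteq> {z. form y z = 0}"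
  proof (rule bracket_span_minimal)
    fix a b
    have "form (bracket a b) y = - form b (bracket (conj a) y)"
      by (rule form_bracket)
    also have "bracket (conj a) y = 0"
      using central by (metis bracket_anti neg_equal_0_iff_equal)
    finally show "bracket a b \<in> {z. form y z = 0}"
      using form_eq_0_sym by simp
  qed (rule subspace_form_kernel)
  then have "form y y = 0"
    using nil by (auto simp: nilpotent_element_def)
  then show ?thesis
    by simp
qed

text \<open>Among the solvable subalgebras containing \<open>S\<close>, one of largest dimension is maximal.\<close>

lemma solvable_subset_borel:
  assumes "subalgebra S" "solvable S"
  shows "\<exists>B. borel_subalgebra B \<and> S \<subseteq> B"
proof -
  obtain A where A: "finite A" "span A = UNIV"
    using finite_spanning by blast
  obtain Bs where Bs: "Bs \<subseteq> A" "independent Bs" "span Bs = UNIV"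
    using maximal_independent_subset[of A] A(2) span_minimal[of A] by (metis span_span span_mono top.extremum_uniqueI)
  interpret fd: finite_dimensional_vector_space scale Bs
    using Bs A(1) finite_subset by unfold_locales auto
  define good where "good B \<longleftrightarrow> subalgebra B \<and> solvable B \<and> S \<subseteq> B" for B
  have "good S" "\<forall>B. good B \<longrightarrow> dim B < Suc (card Bs)"
    using assms fd.dim_subset_UNIV fd.dimension_def by (auto simp: good_def less_Suc_eq_le)
  then obtain B where B: "good B" "\<And>C. good C \<Longrightarrow> dim C \<le> dim B"
    using ex_has_greatest_nat[of good S dim "Suc (card Bs)"] by metis
  have "C = B" if "subalgebra C" "solvable C" "B \<subseteq> C" for C
  proof -
    have "dim C \<le> dim B"
      using that B by (auto simp: good_def)
    then show ?thesis
      using fd.subspace_dim_equal[of B C] that B(1) by (auto simp: good_def subalgebra_def)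
  qed
  then show ?thesis
    using B(1) by (auto simp: borel_subalgebra_def good_def)
qed

end


section \<open>The grading by an imaginary element\<close>

locale graded_unitary_lie_algebra = unitary_lie_algebra scale form bracket conj
  for scale :: "complex \<Rightarrow> 'b::ab_group_add \<Rightarrow> 'b" (infixr "*c" 75)
    and form :: "'b \<Rightarrow> 'b \<Rightarrow> complex"
    and bracket :: "'b \<Rightarrow> 'b \<Rightarrow> 'b"
    and conj :: "'b \<Rightarrow> 'b" +
  fixes w :: 'b
  assumes conj_w: "conj w = - w"
begin

definition eig :: "real \<Rightarrow> 'b set" where
  "eig l = {x. bracket w x = of_real l *c x}"

definition graded_part :: "real set \<Rightarrow> 'b set" where
  "graded_part A = span (\<Union>l\<in>A. eig l)"

definition spectrum :: "real set" where
  "spectrum = {l. eig l \<noteq> {0}}"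

lemma subspace_eig: "subspace (eig l)"
  by (auto simp: subspace_def eig_def bracket_add_right bracket_scale_right scale_right_distrib
      mult.commute)

lemma subspace_graded_part: "subspace (graded_part A)"
  by (simp add: graded_part_def)

lemma eig_subset_graded_part: "l \<in> A \<Longrightarrow> eig l \<subseteq> graded_part A"
  unfolding graded_part_def using span_superset by blast

lemma graded_part_singleton: "graded_part {l} = eig l"
  by (simp add: graded_part_def subspace_eig)

lemma graded_part_empty: "graded_part {} = {0}"
  by (simp add: graded_part_def)

lemma graded_part_mono: "A \<subseteq> B \<Longrightarrow> graded_part A \<subseteq> graded_part B"
  unfolding graded_part_def by (rule span_mono) blast

lemma graded_part_Un: 
  assumes "x \<in> graded_part (A \<union> B)"
  obtains y z where "x = y + z" "y \<in> graded_part A" "z \<in> graded_part B"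
  using assms unfolding graded_part_def UN_Un span_Un by blast

lemma form_ad_w: "form (bracket w x) y = form x (bracket w y)"
  by (simp add: form_bracket conj_w bracket_minus form_minus_right)

lemma form_eig:
  assumes "x \<in> eig l" "y \<in> eig k" "l \<noteq> k"
  shows "form x y = 0"
proof -
  have "of_real l * form x y = of_real k * form x y"
    using form_ad_w[of x y] assms by (simp add: eig_def form_scale_left form_scale_right)
  then show ?thesis
    using assms(3) by simp
qed

lemma form_graded_part:
  assumes "x \<in> graded_part A" "y \<in> graded_part B" "A \<inter> B = {}"
  shows "form x y = 0"
  using _ assms(1,2)[unfolded graded_part_def]
proof (rule form_span_eq_0)
  fix x y assume "x \<in> (\<Union>l\<in>A. eig l)" "y \<in> (\<Union>l\<in>B. eig l)"
  then show "form x y = 0"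
    using assms(3) form_eig by blast
qed

lemma graded_part_disjoint:
  assumes "x \<in> graded_part A" "x \<in> graded_part B" "A \<inter> B = {}"
  shows "x = 0"
  using form_graded_part[OF assms] by simp

lemma conj_eig: "x \<in> eig l \<Longrightarrow> conj x \<in> eig (- l)"
proof -
  assume "x \<in> eig l"
  then have "conj (bracket w x) = of_real l *c conj x"
    by (simp add: eig_def conj_scale)
  then have "- bracket w (conj x) = of_real l *c conj x"
    by (simp add: conj_bracket conj_w bracket_minus)
  then show ?thesis
    by (simp add: eig_def) (metis minus_minus)
qed

lemma conj_graded_part: "x \<in> graded_part A \<Longrightarrow> conj x \<in> graded_part (uminus ` A)"
proof -
  assume "x \<in> graded_part A"
  then have "conj x \<in> span (conj ` (\<Union>l\<in>A. eig l))"
    unfolding graded_part_def by (rule conj_span)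
  moreover have "conj ` (\<Union>l\<in>A. eig l) \<subseteq> (\<Union>l\<in>uminus ` A. eig l)"
    using conj_eig by auto
  ultimately show ?thesis
    unfolding graded_part_def using span_mono by blast
qed

lemma bracket_eig:
  assumes "x \<in> eig l" "y \<in> eig k"
  shows "bracket x y \<in> eig (l + k)"
  using assms bracket_derivation[of w x y]
  by (simp add: eig_def bracket_scale_left bracket_scale_right scale_left_distrib)

text \<open>A sum of degrees outside the spectrum contributes only the zero space. Allowing for this lets
  the finiteness of the spectrum prove nilpotency below.\<close>

lemma bracket_graded_part:
  assumes "\<And>a b. a \<in> A \<Longrightarrow> b \<in> B \<Longrightarrow> a + b \<in> spectrum \<Longrightarrow> a + b \<in> C"
    and "x \<in> graded_part A" "y \<in> graded_part B"
  shows "bracket x y \<in> graded_part C"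
  using _ subspace_graded_part assms(2,3)[unfolded graded_part_def]
proof (rule bracket_mem_span)
  fix x y assume "x \<in> (\<Union>l\<in>A. eig l)" "y \<in> (\<Union>l\<in>B. eig l)"
  then obtain a b where ab: "a \<in> A" "b \<in> B" "x \<in> eig a" "y \<in> eig b"
    by blast
  then have xy: "bracket x y \<in> eig (a + b)"
    using bracket_eig by blast
  show "bracket x y \<in> graded_part C"
  proof (cases "a + b \<in> spectrum")
    case True
    then show ?thesis
      using xy ab assms(1) eig_subset_graded_part by blast
  next
    case False
    then show ?thesis
      using xy subspace_0[OF subspace_graded_part] by (simp add: spectrum_def)
  qed
qed

lemma invariant_subspace_eigenbasis:
  assumes "subspace V" "\<And>x. x \<in> V \<Longrightarrow> bracket w x \<in> V"
  obtains E where "orthonormal_basis V E" "\<And>e. e \<in> E \<Longrightarrow> \<exists>l. e \<in> eig l"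
  using spectral_theorem[of "bracket w" V] assms form_ad_w
  by (fastforce simp: bracket_add_right bracket_scale_right eig_def)

text \<open>A subspace invariant under \<open>ad w\<close> inherits the grading, by the spectral theorem applied to it.\<close>

lemma invariant_subspace_graded:
  assumes "subspace V" "\<And>x. x \<in> V \<Longrightarrow> bracket w x \<in> V"
  shows "V \<subseteq> span (\<Union>l. V \<inter> eig l)"
proof -
  obtain E where E: "orthonormal_basis V E" "\<And>e. e \<in> E \<Longrightarrow> \<exists>l. e \<in> eig l"
    using invariant_subspace_eigenbasis[OF assms] by blast
  then have "E \<subseteq> (\<Union>l. V \<inter> eig l)"
    using span_base[of _ E] by (auto simp: orthonormal_basis_def)
  then show ?thesis
    using E(1) span_mono unfolding orthonormal_basis_def by blast
qed

lemma graded_part_UNIV: "graded_part UNIV = UNIV"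
  using invariant_subspace_graded[of UNIV] by (auto simp: graded_part_def)

lemma invariant_subspace_subset:
  assumes "subspace V" "\<And>x. x \<in> V \<Longrightarrow> bracket w x \<in> V"
    and "\<And>x l. x \<in> V \<Longrightarrow> x \<in> eig l \<Longrightarrow> l \<notin> A \<Longrightarrow> x = 0"
  shows "V \<subseteq> graded_part A"
proof -
  have "(\<Union>l. V \<inter> eig l) \<subseteq> graded_part A"
    using assms(3) eig_subset_graded_part subspace_0[OF subspace_graded_part] by blast
  then show ?thesis
    using invariant_subspace_graded[OF assms(1,2)] span_minimal[OF _ subspace_graded_part] by blast
qed

lemma invariant_subspace_split:
  assumes "subspace V" "\<And>x. x \<in> V \<Longrightarrow> bracket w x \<in> V" and x: "x \<in> V" "x \<in> graded_part (A \<union> B)"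
    and "A \<inter> B = {}"
  obtains y z where "x = y + z" "y \<in> V" "y \<in> graded_part A" "z \<in> V" "z \<in> graded_part B"
proof -
  have "(\<Union>l. V \<inter> eig l) = (\<Union>l\<in>A. V \<inter> eig l) \<union> (\<Union>l\<in>-A. V \<inter> eig l)"
    by auto
  then have "x \<in> span ((\<Union>l\<in>A. V \<inter> eig l) \<union> (\<Union>l\<in>-A. V \<inter> eig l))"
    using invariant_subspace_graded[OF assms(1,2)] x(1) by auto
  then obtain y z where yz: "x = y + z" "y \<in> span (\<Union>l\<in>A. V \<inter> eig l)" "z \<in> span (\<Union>l\<in>-A. V \<inter> eig l)"
    unfolding span_Un by blast
  then have y: "y \<in> V" "y \<in> graded_part A"
    using span_minimal[OF _ assms(1), of "\<Union>l\<in>A. V \<inter> eig l"]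
      span_mono[of "\<Union>l\<in>A. V \<inter> eig l" "\<Union>l\<in>A. eig l"] by (auto simp: graded_part_def)
  have z: "z \<in> V" "z \<in> graded_part (-A)"
    using yz span_minimal[OF _ assms(1), of "\<Union>l\<in>-A. V \<inter> eig l"]
      span_mono[of "\<Union>l\<in>-A. V \<inter> eig l" "\<Union>l\<in>-A. eig l"] by (auto simp: graded_part_def)
  obtain y' z' where yz': "x = y' + z'" "y' \<in> graded_part A" "z' \<in> graded_part B"
    using graded_part_Un[OF x(2)] by blast
  \<comment> \<open>Uniqueness of components: \<open>z - z' = y' - y\<close> lies in two disjoint graded parts.\<close>
  have "z - z' \<in> graded_part (-A)"
    using z(2) yz'(3) graded_part_mono[of B "-A"] assms(5) subspace_diff[OF subspace_graded_part]
    by blast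
  moreover have "z - z' = y' - y"
    using yz(1) yz'(1) by (metis add_diff_cancel_left' add_diff_eq diff_add_eq eq_diff_eq)
  ultimately have "z - z' = 0"
    using subspace_diff[OF subspace_graded_part yz'(2) y(2)]
    by (intro graded_part_disjoint[of "z - z'" A "-A"]) auto
  then show thesis
    using that yz(1) y z(1) yz'(3) by simp
qed

text \<open>By orthogonality of the eigenspaces, every eigenvalue already occurs on a given eigenbasis.\<close>

lemma finite_spectrum: "finite spectrum"
proof -
  obtain E where E: "orthonormal_basis UNIV E" "\<And>e. e \<in> E \<Longrightarrow> \<exists>l. e \<in> eig l"
    using invariant_subspace_eigenbasis[of UNIV] by auto
  then obtain d where d: "e \<in> eig (d e)" if "e \<in> E" for e
    by metis
  have "spectrum \<subseteq> d ` E"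
  proof
    fix l assume "l \<in> spectrum"
    then obtain v where v: "v \<in> eig l" "v \<noteq> 0"
      using subspace_0[OF subspace_eig] by (auto simp: spectrum_def)
    obtain e where "e \<in> E" "form v e \<noteq> 0"
      using v(2) parseval[OF E(1), of v v] by (metis (no_types, lifting) form_self_eq_0 mult_zero_left sum.neutral)
    then show "l \<in> d ` E"
      using form_eig[OF v(1) d[of e]] by blast
  qed
  then show ?thesis
    using orthonormal_finite[of E] E(1) finite_surj[of E] by (simp add: orthonormal_basis_def)
qed

text \<open>Counting the spectral values above a degree turns the grading by reals into a filtration by
  naturals: adding a positive degree moves a degree one step up the filtration, or out of the
  spectrum.\<close>

definition top_degrees :: "nat \<Rightarrow> real set" where
  "top_degrees k = {l. card {m\<in>spectrum. l < m} < k}"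

lemma top_degrees_0: "top_degrees 0 = {}"
  by (simp add: top_degrees_def)

lemma top_degrees_all: "top_degrees (Suc (card spectrum)) = UNIV"
  using card_mono[OF finite_spectrum] by (auto simp: top_degrees_def less_Suc_eq_le)

lemma top_degrees_step:
  assumes "a > 0" "b \<in> top_degrees (Suc k)" "a + b \<in> spectrum"
  shows "a + b \<in> top_degrees k"
proof -
  have "{m\<in>spectrum. a + b < m} \<subseteq> {m\<in>spectrum. b < m}"
    using assms(1) by auto
  moreover have "a + b \<in> {m\<in>spectrum. b < m}" "a + b \<notin> {m\<in>spectrum. a + b < m}"
    using assms(1,3) by simp_all
  ultimately have "{m\<in>spectrum. a + b < m} \<subset> {m\<in>spectrum. b < m}"
    by blast
  then have "card {m\<in>spectrum. a + b < m} < card {m\<in>spectrum. b < m}"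
    using finite_spectrum by (simp add: psubset_card_mono)
  then show ?thesis
    using assms(2) by (simp add: top_degrees_def)
qed

definition nil_part :: "'b set" where
  "nil_part = graded_part {0<..}"

definition parabolic_part :: "'b set" where
  "parabolic_part = graded_part {0..}"

lemma parabolic_decomposition:
  assumes "x \<in> parabolic_part"
  obtains y z where "x = y + z" "y \<in> eig 0" "z \<in> nil_part"
proof -
  have "{0..} = {0} \<union> {0::real<..}"
    by auto
  then show thesis
    using assms that graded_part_Un[of x "{0}" "{0<..}"]
    by (metis graded_part_singleton nil_part_def parabolic_part_def)
qed

lemma nil_part_subset: "nil_part \<subseteq> parabolic_part"
  unfolding nil_part_def parabolic_part_def by (rule graded_part_mono) auto

lemma eig_0_subset: "eig 0 \<subseteq> parabolic_part"
  unfolding parabolic_part_def by (rule eig_subset_graded_part) auto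

lemma w_in_eig_0: "w \<in> eig 0"
  by (simp add: eig_def bracket_self)

lemma bracket_parabolic_nil:
  "x \<in> parabolic_part \<Longrightarrow> y \<in> nil_part \<Longrightarrow> bracket x y \<in> nil_part"
  unfolding nil_part_def parabolic_part_def by (rule bracket_graded_part[of "{0..}" "{0<..}"]) auto

lemma subalgebra_parabolic_part: "subalgebra parabolic_part"
  unfolding subalgebra_def parabolic_part_def
  by (auto simp: subspace_graded_part intro!: bracket_graded_part[of "{0..}" "{0..}"])

lemma subspace_nil_part: "subspace nil_part"
  by (simp add: nil_part_def subspace_graded_part)

text \<open>Conjugation reverses degrees, so only degree zero survives.\<close>

lemma parabolic_Int_conj: "parabolic_part \<inter> conj ` parabolic_part = eig 0"
proof (intro equalityI subsetI)
  fix x assume "x \<in> eig 0"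
  then show "x \<in> parabolic_part \<inter> conj ` parabolic_part"
    using eig_0_subset conj_eig[of x 0] by (auto simp: mem_conj_image)
next
  fix x assume "x \<in> parabolic_part \<inter> conj ` parabolic_part"
  then have x: "x \<in> parabolic_part" "conj x \<in> parabolic_part"
    by (auto simp: mem_conj_image)
  obtain y z where yz: "x = y + z" "y \<in> eig 0" "z \<in> nil_part"
    using parabolic_decomposition[OF x(1)] by blast
  have "x \<in> graded_part {..0}"
    using conj_graded_part[of "conj x" "{0..}"] x(2) by (simp add: parabolic_part_def)
  moreover have "y \<in> graded_part {..0}"
    using yz(2) eig_subset_graded_part[of 0 "{..0}"] by auto
  ultimately have "z \<in> graded_part {..0}"
    using subspace_diff[OF subspace_graded_part, of x "{..0}" y] yz(1) by simp
  then have "z = 0"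
    using yz(3) graded_part_disjoint[of z "{..0}" "{0<..}"]
    by (fastforce simp: nil_part_def)
  then show "x \<in> eig 0"
    using yz by simp
qed

text \<open>By \<open>top_degrees_step\<close>, each application of \<open>ad x\<close> lowers the index of the filtration. Every
  \<open>v\<close> of degree \<open>l \<noteq> 0\<close> is a bracket, namely \<open>[w, v] / l\<close>.\<close>

lemma nil_part_nilpotent:
  assumes "x \<in> nil_part"
  shows "nilpotent_element x"
proof -
  have step: "bracket x y \<in> graded_part (top_degrees k)" if "y \<in> graded_part (top_degrees (Suc k))" for y k
    using _ assms[unfolded nil_part_def] that
    by (rule bracket_graded_part) (auto intro: top_degrees_step)
  define N where "N = Suc (card spectrum)"
  have "(bracket x ^^ k) y \<in> graded_part (top_degrees (N - k))" if "k \<le> N" for y k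
    using that
  proof (induction k)
    case 0
    then show ?case
      by (simp add: N_def top_degrees_all graded_part_UNIV)
  next
    case (Suc k)
    then show ?case
      using step[of "(bracket x ^^ k) y" "N - Suc k"] by (simp add: Suc_diff_Suc)
  qed
  from this[of N] have "bracket x ^^ N = (\<lambda>_. 0)"
    by (auto simp: top_degrees_0 graded_part_empty)
  moreover have "nil_part \<subseteq> bracket_span UNIV UNIV"
    unfolding nil_part_def graded_part_def
  proof (rule span_minimal)
    show "(\<Union>l\<in>{0<..}. eig l) \<subseteq> bracket_span UNIV UNIV"
    proof safe
      fix x and l :: real assume x: "x \<in> eig l" "l > 0"
      have "bracket w x \<in> bracket_span UNIV UNIV"
        by (rule bracket_in_bracket_span) auto
      then have "of_real (1 / l) *c bracket w x \<in> bracket_span UNIV UNIV"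
        using subspace_bracket_span subspace_scale by blast
      then show "x \<in> bracket_span UNIV UNIV"
        using x by (simp add: eig_def)
    qed
  qed (rule subspace_bracket_span)
  ultimately show ?thesis
    using assms by (auto simp: nilpotent_element_def)
qed

subsection \<open>The nil-radical\<close>

text \<open>On an eigenspace, the power \<open>(ad (y + z))\<^sup>k\<close> agrees with \<open>(ad y)\<^sup>k\<close> up to terms of higher degree,
  and the latter preserves the degree. So if the first power vanishes, both parts vanish.\<close>

lemma nilpotent_degree_zero_component:
  assumes x: "nilpotent_element (y + z)" and y: "y \<in> eig 0" and z: "z \<in> nil_part"
  shows "nilpotent_element y"
proof -
  obtain N where N: "bracket (y + z) ^^ N = (\<lambda>_. 0)"
    using x by (auto simp: nilpotent_element_def)
  have y_eig: "(bracket y ^^ k) v \<in> eig l" if "v \<in> eig l" for k v l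
    using that by (induction k) (use bracket_eig[OF y] in auto)
  have higher: "(bracket (y + z) ^^ k) v - (bracket y ^^ k) v \<in> graded_part {l<..}" if "v \<in> eig l" for k v l
  proof (induction k)
    case 0
    then show ?case
      by (simp add: subspace_0[OF subspace_graded_part])
  next
    case (Suc k)
    let ?u = "(bracket (y + z) ^^ k) v" and ?u' = "(bracket y ^^ k) v"
    have "y + z \<in> graded_part {0..}"
      using y z eig_0_subset nil_part_subset subspace_add[OF subspace_graded_part]
      unfolding parabolic_part_def by blast
    then have "bracket (y + z) (?u - ?u') \<in> graded_part {l<..}"
      using Suc by (rule bracket_graded_part[rotated]) auto
    moreover have "bracket z ?u' \<in> graded_part {l<..}"
      using z y_eig[OF that, of k] graded_part_singleton[of l] unfolding nil_part_def
      by (intro bracket_graded_part[of "{0<..}" "{l}"]) auto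
    moreover have "bracket (y + z) ?u - bracket y ?u' = bracket (y + z) (?u - ?u') + bracket z ?u'"
      by (simp add: bracket_diff bracket_add_left)
    ultimately show ?case
      by (simp add: subspace_add[OF subspace_graded_part])
  qed
  have eig0: "(bracket y ^^ N) v = 0" if "v \<in> eig l" for v l
  proof -
    have "- (bracket y ^^ N) v \<in> graded_part {l<..}"
      using higher[OF that, of N] by (simp add: N)
    then have "(bracket y ^^ N) v \<in> graded_part {l<..}"
      using subspace_neg[OF subspace_graded_part] by fastforce
    then show ?thesis
      using y_eig[OF that, of N] graded_part_disjoint[of _ "{l<..}" "{l}"]
      by (simp add: graded_part_singleton)
  qed
  have add: "(bracket y ^^ k) (u + v) = (bracket y ^^ k) u + (bracket y ^^ k) v" for k u v
    by (induction k) (auto simp: bracket_add_right)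
  have scale: "(bracket y ^^ k) (c *c v) = c *c (bracket y ^^ k) v" for k c v
    by (induction k) (auto simp: bracket_scale_right)
  have "subspace {v. (bracket y ^^ N) v = 0}"
    using scale[of N 0 0] by (auto simp: subspace_def add scale)
  then have "graded_part UNIV \<subseteq> {v. (bracket y ^^ N) v = 0}"
    unfolding graded_part_def by (intro span_minimal) (auto simp: eig0)
  then have "bracket y ^^ N = (\<lambda>_. 0)"
    by (auto simp: graded_part_UNIV)
  moreover have "y \<in> bracket_span UNIV UNIV"
    using x nil_part_nilpotent[OF z] subspace_diff[OF subspace_bracket_span, of "y + z" UNIV UNIV z]
    by (simp add: nilpotent_element_def)
  ultimately show ?thesis
    by (auto simp: nilpotent_element_def)
qed

text \<open>For \<open>x = y + z\<close> in the nil ideal, with \<open>y\<close> of degree zero and \<open>z\<close> in the nil part, also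
  \<open>[conj y, x]\<close> lies in the ideal, and its degree-zero component \<open>Y = [conj y, y]\<close> satisfies
  \<open>conj Y = - Y\<close>. So \<open>Y\<close> is a nilpotent element commuting with its conjugate and vanishes; hence \<open>y\<close>
  commutes with its conjugate and vanishes for the same reason.\<close>

lemma nil_ideal_subset_nil_part:
  assumes "nil_ideal_of parabolic_part I"
  shows "I \<subseteq> nil_part"
proof
  have ideal: "bracket x y \<in> I" if "x \<in> parabolic_part" "y \<in> I" for x y
    using assms that by (auto simp: nil_ideal_of_def ideal_of_def)
  have commuting: "y = 0" if "y + z \<in> I" "y \<in> eig 0" "z \<in> nil_part" "bracket y (conj y) = 0" for y z
  proof -
    have "nilpotent_element (y + z)"
      using assms that(1) by (auto simp: nil_ideal_of_def)
    then show ?thesis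
      using normal_nilpotent_eq_0[OF that(4)] nilpotent_degree_zero_component that(2,3) by blast
  qed
  fix x assume "x \<in> I"
  then have "x \<in> parabolic_part"
    using assms by (auto simp: nil_ideal_of_def ideal_of_def)
  then obtain y z where yz: "x = y + z" "y \<in> eig 0" "z \<in> nil_part"
    using parabolic_decomposition by blast
  have cy: "conj y \<in> eig 0"
    using conj_eig[OF yz(2)] by simp
  let ?Y = "bracket (conj y) y"
  have "?Y = 0"
  proof (rule commuting)
    show "?Y + bracket (conj y) z \<in> I"
      using ideal[of "conj y" x] \<open>x \<in> I\<close> cy eig_0_subset yz(1) by (auto simp: bracket_add_right)
    show "?Y \<in> eig 0"
      using bracket_eig[OF cy yz(2)] by simp
    show "bracket (conj y) z \<in> nil_part"
      using cy eig_0_subset yz(3) bracket_parabolic_nil by blast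
    have "conj ?Y = - ?Y"
      by (metis bracket_anti conj_bracket conj_conj)
    then show "bracket ?Y (conj ?Y) = 0"
      by (simp add: bracket_minus bracket_self)
  qed
  then have "bracket y (conj y) = 0"
    by (metis bracket_anti neg_equal_0_iff_equal)
  then have "y = 0"
    using commuting[of y z] yz \<open>x \<in> I\<close> by simp
  then show "x \<in> nil_part"
    using yz by simp
qed

lemma nil_radical_parabolic_part: "nil_radical parabolic_part = nil_part"
proof -
  have "nil_ideal_of parabolic_part nil_part"
    by (auto simp: nil_ideal_of_def ideal_of_def subspace_nil_part bracket_parabolic_nil
        nil_part_nilpotent nil_part_subset[THEN subsetD])
  then show ?thesis
    unfolding nil_radical_def using nil_ideal_subset_nil_part
    by (intro the_equality) blast+
qed

subsection \<open>Parabolicity\<close>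

text \<open>The element \<open>w\<close> is adjoined to the nil part because any subalgebra containing it is graded.\<close>

lemma derived_nil_part_w: "derived (span (insert w nil_part)) \<subseteq> nil_part"
proof -
  have mem: "bracket x y \<in> nil_part" if "x \<in> insert w nil_part" "y \<in> insert w nil_part" for x y
  proof -
    have "bracket z w \<in> nil_part" if "z \<in> nil_part" for z
      using bracket_parabolic_nil[of w z] that w_in_eig_0 eig_0_subset bracket_anti[of z w]
        subspace_neg[OF subspace_nil_part] by auto
    then show ?thesis
      using that bracket_parabolic_nil w_in_eig_0 eig_0_subset nil_part_subset
        subspace_0[OF subspace_nil_part] by (auto simp: bracket_self)
  qed
  show ?thesis
    by (rule bracket_span_minimal[OF bracket_mem_span[OF mem subspace_nil_part] subspace_nil_part])
qed

lemma solvable_nil_part_w: "solvable (span (insert w nil_part))"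
proof -
  let ?S = "span (insert w nil_part)"
  define N where "N = Suc (card spectrum)"
  have "(derived ^^ k) nil_part \<subseteq> graded_part (top_degrees (N - k) \<inter> {0<..})" if "k \<le> N" for k
    using that
  proof (induction k)
    case 0
    then show ?case
      by (simp add: N_def top_degrees_all nil_part_def)
  next
    case (Suc k)
    let ?A = "\<lambda>k. top_degrees k \<inter> {0<..}"
    have "derived (graded_part (?A (Suc j))) \<subseteq> graded_part (?A j)" for j
      by (rule bracket_span_minimal[OF bracket_graded_part subspace_graded_part])
        (use top_degrees_step in auto)
    moreover have "(derived ^^ k) nil_part \<subseteq> graded_part (?A (Suc (N - Suc k)))"
      using Suc by (simp add: Suc_diff_Suc)
    then have "derived ((derived ^^ k) nil_part) \<subseteq> derived (graded_part (?A (Suc (N - Suc k))))"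
      by (intro bracket_span_mono)
    ultimately show ?case
      by (simp only: funpow.simps o_apply) blast
  qed
  from this[of N] have "(derived ^^ N) nil_part \<subseteq> {0}"
    by (simp add: top_degrees_0 graded_part_empty)
  then have "(derived ^^ Suc N) ?S \<subseteq> {0}"
    using derived_funpow_mono[OF derived_nil_part_w, of N] by (simp only: funpow_Suc_right o_apply)
  then have "(derived ^^ Suc N) ?S = {0}"
    using zero_in_derived_funpow[OF span_zero, of "Suc N" "insert w nil_part"] by blast
  then show ?thesis
    unfolding solvable_def by blast
qed

text \<open>Since \<open>w \<in> B\<close>, the subalgebra \<open>B\<close> is graded. If it had an element \<open>x\<close> of negative degree, then
  \<open>conj x\<close> would lie in the nil part and so in \<open>B\<close>. Then \<open>x\<close> and \<open>w\<close> lie in the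
  conjugation-stable solvable subalgebra \<open>B \<inter> conj B\<close>, which is abelian, whereas \<open>[w, x]\<close> is a nonzero
  multiple of \<open>x\<close>.\<close>

lemma solvable_subset_parabolic_part:
  assumes B: "subalgebra B" "solvable B" and w: "w \<in> B" and n: "nil_part \<subseteq> B"
  shows "B \<subseteq> parabolic_part"
  unfolding parabolic_part_def
proof (rule invariant_subspace_subset)
  show "bracket w x \<in> B" if "x \<in> B" for x
    using B(1) w that by (auto simp: subalgebra_def)
next
  show "subspace B"
    using B(1) by (auto simp: subalgebra_def)
next
  fix x l assume x: "x \<in> B" "x \<in> eig l" and "l \<notin> {0..}"
  then have "conj x \<in> nil_part"
    using conj_eig[OF x(2)] eig_subset_graded_part[of "- l" "{0<..}"] by (auto simp: nil_part_def)
  then have "conj x \<in> B"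
    using n by blast
  let ?L = "B \<inter> conj ` B"
  have "subalgebra ?L"
    using B(1) by (auto simp: subalgebra_def subspace_inter subspace_conj_image mem_conj_image conj_bracket)
  moreover have "solvable ?L"
    using B(2) by (rule solvable_subset)
      (use \<open>subalgebra ?L\<close> subspace_0 in \<open>auto simp: subalgebra_def\<close>)
  moreover have "conj ` ?L \<subseteq> ?L"
    by (auto simp: mem_conj_image)
  moreover have "w \<in> ?L" "x \<in> ?L"
    using w B(1) x(1) \<open>conj x \<in> B\<close>
    by (auto simp: mem_conj_image conj_w subalgebra_def intro: subspace_neg)
  ultimately have "bracket w x = 0"
    using conj_stable_solvable_abelian by blast
  then show "x = 0"
    using x(2) \<open>l \<notin> {0..}\<close> by (simp add: eig_def)
qed

text \<open>Any Borel subalgebra containing \<open>w\<close> and the nil part does the job.\<close>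

lemma parabolic_parabolic_part: "parabolic parabolic_part"
proof -
  let ?S = "span (insert w nil_part)"
  have "derived ?S \<subseteq> ?S"
    using derived_nil_part_w span_superset[of "insert w nil_part"] by auto
  then have "subalgebra ?S"
    using bracket_in_bracket_span by (auto simp: subalgebra_def)
  then obtain B where B: "borel_subalgebra B" "?S \<subseteq> B"
    using solvable_subset_borel solvable_nil_part_w by blast
  moreover have "w \<in> B" "nil_part \<subseteq> B"
    using B(2) span_superset[of "insert w nil_part"] by auto
  ultimately have "B \<subseteq> parabolic_part"
    using solvable_subset_parabolic_part by (simp add: borel_subalgebra_def)
  then show ?thesis
    using B(1) subalgebra_parabolic_part unfolding parabolic_def by blast
qed

end


section \<open>Subalgebras spanning with their conjugate\<close>

text \<open>The model is the preimage of the \<open>\<i>\<close>-eigenspace of an integrable complex structure on a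
  quotient by \<open>h\<close>; then \<open>q \<inter> conj ` q\<close> is the complexification of \<open>h\<close>.\<close>

locale transversal_subalgebra = unitary_lie_algebra scale form bracket conj
  for scale :: "complex \<Rightarrow> 'b::ab_group_add \<Rightarrow> 'b" (infixr "*c" 75)
    and form :: "'b \<Rightarrow> 'b \<Rightarrow> complex"
    and bracket :: "'b \<Rightarrow> 'b \<Rightarrow> 'b"
    and conj :: "'b \<Rightarrow> 'b" +
  fixes q :: "'b set"
  assumes subalgebra_q: "subalgebra q"
    and q_spanning: "\<exists>a\<in>q. \<exists>b\<in>q. x = a + conj b"
begin

lemma subspace_q: "subspace q" and bracket_q: "x \<in> q \<Longrightarrow> y \<in> q \<Longrightarrow> bracket x y \<in> q"
  using subalgebra_q by (auto simp: subalgebra_def)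

subsection \<open>The trace element\<close>

context
  fixes E F :: "'b set"
  assumes E: "orthonormal_basis q E" and F: "orthonormal_basis (perp q) F"
begin

text \<open>This is the trace of \<open>P \<circ> ad x\<close> on \<open>q\<close>, where \<open>P\<close> is the orthogonal projection onto \<open>q\<close>.\<close>

definition compressed_trace :: "'b \<Rightarrow> complex" where
  "compressed_trace x = (\<Sum>e\<in>E. form (bracket x e) e)"

definition trace_element :: 'b where
  "trace_element = (\<Sum>g\<in>E \<union> F. cnj (compressed_trace g) *c g)"

lemma basis_EF: "orthonormal_basis UNIV (E \<union> F)" and disjoint_EF: "E \<inter> F = {}"
  using orthonormal_basis_Un_perp[OF E F] by blast+

lemma finite_EF: "finite E" "finite F"
  using E F orthonormal_finite by (auto simp: orthonormal_basis_def)

lemma E_subset: "e \<in> E \<Longrightarrow> e \<in> q"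
  using E span_base by (auto simp: orthonormal_basis_def)

lemma form_q_F: "x \<in> q \<Longrightarrow> f \<in> F \<Longrightarrow> form x f = 0"
  using F span_base form_eq_0_sym by (fastforce simp: orthonormal_basis_def perp_def)

lemma in_q_iff: "x \<in> q \<longleftrightarrow> (\<forall>f\<in>F. form x f = 0)"
proof
  assume *: "\<forall>f\<in>F. form x f = 0"
  have "x = (\<Sum>g\<in>E \<union> F. form x g *c g)"
    using basis_EF orthonormal_expansion by (auto simp: orthonormal_basis_def)
  then have "x = (\<Sum>g\<in>E. form x g *c g)"
    using * by (simp add: sum.union_disjoint finite_EF disjoint_EF)
  then show "x \<in> q"
    by (metis (no_types, lifting) E_subset subspace_q subspace_scale subspace_sum)
qed (use form_q_F in blast)

lemma form_split: "form x y = (\<Sum>e\<in>E. form x e * cnj (form y e)) + (\<Sum>f\<in>F. form x f * cnj (form y f))"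
  using parseval[OF basis_EF, of x y] by (simp add: sum.union_disjoint finite_EF disjoint_EF)

lemma compressed_trace: "compressed_trace x = form x trace_element"
  unfolding trace_element_def
  by (rule functional_representation[OF _ _ basis_EF])
    (simp_all add: compressed_trace_def bracket_add_left bracket_scale_left form_add_left
      form_scale_left sum.distrib sum_distrib_left)

text \<open>Passing from \<open>ad x\<close> to \<open>ad (conj x)\<close> replaces the compression by minus its adjoint, so the trace
  by minus its complex conjugate.\<close>

lemma conj_trace_element: "conj trace_element = - trace_element"
proof -
  let ?w = trace_element
  have "form (conj x) ?w = - form (conj x) (conj ?w)" for x
  proof -
    have "compressed_trace (conj x) = - cnj (compressed_trace x)"
      by (simp add: compressed_trace_def form_bracket form_cnj sum_negf)
    then show ?thesis
      by (simp add: compressed_trace form_conj)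
  qed
  then have "form x ?w = form x (- conj ?w)" for x
    by (metis conj_conj form_minus_right)
  then have "?w = - conj ?w"
    by (intro form_eqI) (metis form_cnj)
  then show ?thesis
    by (metis minus_minus)
qed

text \<open>With \<open>A = ad x\<close>, whose adjoint is \<open>- ad (conj x)\<close>, the left-hand side is the trace on \<open>q\<close> of the
  compression of \<open>A A* - A* A\<close>. Let \<open>a\<close> and \<open>b\<close> be the blocks of \<open>A\<close> mapping \<open>q\<close> and its complement
  into \<open>q\<close>; the block leading out of \<open>q\<close> vanishes since \<open>q\<close> is a subalgebra. The trace is that of
  \<open>a a* + b b* - a* a\<close>, where the two terms in \<open>a\<close> cancel.\<close>

lemma form_trace_element:
  assumes "x \<in> q"
  shows "form (bracket trace_element x) x
    = of_real (\<Sum>e\<in>E. \<Sum>f\<in>F. (norm (form e (bracket x f)))\<^sup>2)"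
proof -
  let ?c = "conj x"
  let ?N = "\<lambda>e g. form e (bracket x g) * cnj (form e (bracket x g))"
  have c: "form (bracket ?c e) (bracket ?c e) = (\<Sum>g\<in>E. ?N e g) + (\<Sum>f\<in>F. ?N e f)" for e
  proof -
    have eq: "form (bracket ?c e) g * cnj (form (bracket ?c e) g) = ?N e g" for g
      by (simp add: form_bracket)
    show ?thesis
      by (rule form_split[of "bracket ?c e" "bracket ?c e", unfolded eq])
  qed
  have x: "form (bracket x e) (bracket x e) = (\<Sum>g\<in>E. ?N g e)" if "e \<in> E" for e
  proof -
    have "(\<Sum>f\<in>F. ?N f e) = 0"
      using form_q_F[OF bracket_q[OF assms E_subset[OF that]]] form_eq_0_sym by simp
    moreover have eq: "form (bracket x e) g * cnj (form (bracket x e) g) = ?N g e" for g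
      by (simp add: form_cnj mult.commute)
    ultimately show ?thesis
      using form_split[of "bracket x e" "bracket x e", unfolded eq] by simp
  qed
  have "compressed_trace (bracket ?c x)
      = (\<Sum>e\<in>E. form (bracket ?c e) (bracket ?c e) - form (bracket x e) (bracket x e))"
    unfolding compressed_trace_def
  proof (rule sum.cong)
    fix e
    have "bracket (bracket ?c x) e = bracket ?c (bracket x e) - bracket x (bracket ?c e)"
      by (simp add: bracket_derivation[of ?c x e])
    then show "form (bracket (bracket ?c x) e) e
        = form (bracket ?c e) (bracket ?c e) - form (bracket x e) (bracket x e)"
      by (simp add: form_diff_left form_bracket[of ?c "bracket x e"] form_bracket[of x "bracket ?c e"])
  qed simp
  also have "\<dots> = (\<Sum>e\<in>E. \<Sum>g\<in>E. ?N e g) + (\<Sum>e\<in>E. \<Sum>f\<in>F. ?N e f) - (\<Sum>e\<in>E. \<Sum>g\<in>E. ?N g e)"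
    by (simp add: c x sum.distrib sum_subtractf)
  also have "(\<Sum>e\<in>E. \<Sum>g\<in>E. ?N g e) = (\<Sum>e\<in>E. \<Sum>g\<in>E. ?N e g)"
    by (rule sum.swap)
  finally have trace: "compressed_trace (bracket ?c x) = (\<Sum>e\<in>E. \<Sum>f\<in>F. ?N e f)"
    by simp
  have "form (bracket trace_element x) x = form trace_element (bracket ?c x)"
    by (metis bracket_anti form_bracket form_minus_left minus_minus)
  also have "\<dots> = cnj (compressed_trace (bracket ?c x))"
    by (simp add: compressed_trace form_cnj)
  finally show ?thesis
    by (simp only: trace of_real_sum complex_norm_square cnj_sum complex_cnj_mult complex_cnj_cnj
        mult.commute)
qed

text \<open>The vanishing of all terms \<open>\<langle>e, [x, f]\<rangle>\<close> says that \<open>[conj x, e]\<close> is orthogonal to the complement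
  of \<open>q\<close>.\<close>

lemma form_trace_element_eq_0:
  assumes "x \<in> q" "form (bracket trace_element x) x = 0" "y \<in> q"
  shows "bracket (conj x) y \<in> q"
proof -
  let ?t = "\<lambda>e f. (norm (form e (bracket x f)))\<^sup>2"
  have "(\<Sum>e\<in>E. \<Sum>f\<in>F. ?t e f) = 0"
    using form_trace_element[OF assms(1)] assms(2) of_real_eq_0_iff by metis
  then have "\<forall>e\<in>E. (\<Sum>f\<in>F. ?t e f) = 0"
    by (subst (asm) sum_nonneg_eq_0_iff) (auto simp: finite_EF sum_nonneg)
  then have "form e (bracket x f) = 0" if "e \<in> E" "f \<in> F" for e f
    using that by (simp add: sum_nonneg_eq_0_iff finite_EF)
  then have "bracket (conj x) e \<in> q" if "e \<in> E" for e
    using that by (simp add: in_q_iff form_bracket)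
  then show ?thesis
    using bracket_mem_span[of "{conj x}" E q "conj x" y] subspace_q assms(3) E span_base
    by (auto simp: orthonormal_basis_def)
qed

text \<open>Let \<open>r\<close> be a real element congruent to \<open>w\<close> modulo \<open>q\<close>. As \<open>q\<close> is a subalgebra, the operators
  \<open>ad w\<close> and \<open>ad r\<close> have the same block leading out of \<open>q\<close>. The first is self-adjoint and the second
  skew-adjoint, so in the trace of the compression of \<open>[ad w, ad r]\<close> the diagonal blocks cancel, and the
  off-diagonal ones add up to twice the squared norm of the common block. But this trace is
  \<open>\<langle>[w, r], w\<rangle> = 0\<close>.\<close>

lemma trace_element_normalizes:
  assumes "y \<in> q"
  shows "bracket trace_element y \<in> q"
proof -
  let ?w = trace_element
  obtain a b where "a \<in> q" "b \<in> q" "?w = a + conj b"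
    using q_spanning by blast
  \<comment> \<open>Modulo \<open>q\<close> one may replace \<open>a\<close> by \<open>b\<close>, which makes \<open>a + conj b\<close> real.\<close>
  define r where "r = b + conj b"
  have r: "conj r = r"
    by (simp add: r_def conj_add add.commute)
  have wr: "?w - r \<in> q"
    using \<open>?w = _\<close> \<open>a \<in> q\<close> \<open>b \<in> q\<close> subspace_q by (auto simp: r_def subspace_diff)
  let ?R = "\<lambda>e g. form (bracket r e) g" and ?W = "\<lambda>e g. form (bracket ?w e) g"
  have F_eq: "?R e f = ?W e f" if "e \<in> E" "f \<in> F" for e f
    using form_q_F[OF bracket_q[OF wr E_subset[OF that(1)]] that(2)]
    by (simp add: bracket_diff form_diff_left)
  have W: "cnj (?W e g) = ?W g e" and R: "cnj (?R e g) = - ?R g e" for e g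
    by (simp_all add: form_bracket form_cnj conj_trace_element bracket_minus form_minus_right r)
  have cross: "form (bracket r e) (bracket ?w e) + form (bracket ?w e) (bracket r e)
      = (\<Sum>g\<in>E. ?R e g * ?W g e) - (\<Sum>g\<in>E. ?W e g * ?R g e)
        + 2 * (\<Sum>f\<in>F. of_real ((norm (?W e f))\<^sup>2))" if "e \<in> E" for e
  proof -
    have "(\<Sum>f\<in>F. ?R e f * cnj (?W e f)) = (\<Sum>f\<in>F. of_real ((norm (?W e f))\<^sup>2))"
         "(\<Sum>f\<in>F. ?W e f * cnj (?R e f)) = (\<Sum>f\<in>F. of_real ((norm (?W e f))\<^sup>2))"
      by (auto intro!: sum.cong simp: F_eq[OF that] complex_norm_square simp del: of_real_power)
    then show ?thesis
      by (simp only: form_split[of "bracket r e" "bracket ?w e"]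
          form_split[of "bracket ?w e" "bracket r e"] W R) (simp add: sum_negf)
  qed
  have "compressed_trace (bracket ?w r) = (\<Sum>e\<in>E. form (bracket r e) (bracket ?w e) + form (bracket ?w e) (bracket r e))"
    unfolding compressed_trace_def
  proof (rule sum.cong)
    fix e
    have "bracket (bracket ?w r) e = bracket ?w (bracket r e) - bracket r (bracket ?w e)"
      by (simp add: bracket_derivation[of ?w r e])
    then show "form (bracket (bracket ?w r) e) e
        = form (bracket r e) (bracket ?w e) + form (bracket ?w e) (bracket r e)"
      by (simp add: form_diff_left form_bracket[of ?w "bracket r e"] form_bracket[of r "bracket ?w e"]
          conj_trace_element bracket_minus form_minus_right r)
  qed simp
  also have "\<dots> = (\<Sum>e\<in>E. \<Sum>g\<in>E. ?R e g * ?W g e) - (\<Sum>e\<in>E. \<Sum>g\<in>E. ?W e g * ?R g e)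
      + 2 * (\<Sum>e\<in>E. \<Sum>f\<in>F. of_real ((norm (?W e f))\<^sup>2))"
    by (simp add: cross sum.distrib sum_subtractf sum_distrib_left)
  also have "(\<Sum>e\<in>E. \<Sum>g\<in>E. ?W e g * ?R g e) = (\<Sum>e\<in>E. \<Sum>g\<in>E. ?R e g * ?W g e)"
    by (subst sum.swap) (simp add: mult.commute)
  finally have "compressed_trace (bracket ?w r) = of_real (2 * (\<Sum>e\<in>E. \<Sum>f\<in>F. (norm (?W e f))\<^sup>2))"
    by simp
  moreover have "compressed_trace (bracket ?w r) = 0"
  proof -
    have "form (bracket ?w r) ?w = 0"
      by (simp add: form_bracket conj_trace_element bracket_minus bracket_self)
    then show ?thesis
      by (simp add: compressed_trace)
  qed
  ultimately have "(\<Sum>e\<in>E. \<Sum>f\<in>F. (norm (?W e f))\<^sup>2) = 0"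
    by (metis mult_eq_0_iff of_real_eq_0_iff zero_neq_numeral)
  then have "\<forall>e\<in>E. (\<Sum>f\<in>F. (norm (?W e f))\<^sup>2) = 0"
    by (subst (asm) sum_nonneg_eq_0_iff) (auto simp: finite_EF sum_nonneg)
  then have "form (bracket ?w e) f = 0" if "e \<in> E" "f \<in> F" for e f
    using that by (simp add: sum_nonneg_eq_0_iff finite_EF)
  then have "bracket ?w e \<in> q" if "e \<in> E" for e
    using that by (simp add: in_q_iff)
  then show ?thesis
    using bracket_mem_span[of "{?w}" E q ?w y] subspace_q assms E span_base
    by (auto simp: orthonormal_basis_def)
qed

end

lemma normalizing_imaginary_element:
  obtains w where "conj w = - w" "\<And>x. x \<in> q \<Longrightarrow> bracket w x \<in> q"
    "\<And>x. x \<in> q \<Longrightarrow> Re (form (bracket w x) x) \<ge> 0"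
    "\<And>x y. x \<in> q \<Longrightarrow> form (bracket w x) x = 0 \<Longrightarrow> y \<in> q \<Longrightarrow> bracket (conj x) y \<in> q"
proof -
  obtain E F where EF: "orthonormal_basis q E" "orthonormal_basis (perp q) F"
    using orthonormal_basis_exists subspace_q subspace_perp by blast
  have "Re (form (bracket (trace_element E F) x) x) \<ge> 0" if "x \<in> q" for x
    unfolding form_trace_element[OF EF that] by (simp add: sum_nonneg)
  then show thesis
    using that[of "trace_element E F"] conj_trace_element[OF EF] trace_element_normalizes[OF EF]
      form_trace_element_eq_0[OF EF] by blast
qed

subsection \<open>The parabolic subalgebra\<close>

text \<open>In the proof, \<open>eig 0\<close> is \<open>p \<inter> conj ` p\<close>, and \<open>K\<close> is the orthogonal complement of the ideal
  \<open>q \<inter> conj ` q\<close> inside the part of \<open>q\<close> of degree zero. Both \<open>K\<close> and \<open>conj ` K\<close> are ideals of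
  \<open>eig 0\<close> commuting with each other, since a bracket between them lies both in \<open>q \<inter> conj ` q\<close> and in
  its complement. The adjunction then makes \<open>K\<close> abelian and so central in \<open>eig 0\<close>. This yields the
  last clause: up to central elements, the real points of \<open>p\<close> are those of \<open>q\<close>.\<close>

theorem parabolic_of_transversal:
  obtains p where
    "parabolic p" "subspace p" "q \<inter> conj ` q \<subseteq> p"
    "nil_radical p \<subseteq> q" "nil_radical p \<inter> conj ` p = {0}" 
    "\<forall>x\<in>q. \<exists>y z. x = y + z \<and> y \<in> q \<inter> (p \<inter> conj ` p) \<and> z \<in> nil_radical p"
    "\<forall>x\<in>p \<inter> conj ` p. \<exists>a\<in>q \<inter> (p \<inter> conj ` p). \<exists>b\<in>q \<inter> (p \<inter> conj ` p). x = a + conj b"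
    "\<forall>x\<in>p. conj x = x \<longrightarrow>
      (\<exists>u k. x = u + k \<and> u \<in> q \<inter> conj ` q \<and> conj u = u \<and> (\<forall>y\<in>p \<inter> conj ` p. bracket k y = 0))"
proof -
  obtain w where w: "conj w = - w" and wq: "\<And>x. x \<in> q \<Longrightarrow> bracket w x \<in> q"
    and pos: "\<And>x. x \<in> q \<Longrightarrow> Re (form (bracket w x) x) \<ge> 0"
    and null: "\<And>x y. x \<in> q \<Longrightarrow> form (bracket w x) x = 0 \<Longrightarrow> y \<in> q \<Longrightarrow> bracket (conj x) y \<in> q"
    using normalizing_imaginary_element by blast
  interpret graded_unitary_lie_algebra scale form bracket conj w
    by unfold_locales (rule w)
  have conj0: "conj x \<in> eig 0" if "x \<in> eig 0" for x
    using conj_eig[OF that] by simp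
  have subalg0: "bracket x y \<in> eig 0" if "x \<in> eig 0" "y \<in> eig 0" for x y
    using bracket_eig[OF that] by simp
  \<comment> \<open>An element of \<open>q\<close> of degree \<open>l\<close> satisfies \<open>0 \<le> \<langle>[w, x], x\<rangle> = l \<langle>x, x\<rangle>\<close>.\<close>
  have q_sub: "q \<subseteq> parabolic_part"
    unfolding parabolic_part_def
  proof (rule invariant_subspace_subset[OF subspace_q wq])
    fix x l assume x: "x \<in> q" "x \<in> eig l" "l \<notin> {0..}"
    have "form (bracket w x) x = of_real l * form x x"
      using x(2) by (simp add: eig_def form_scale_left)
    then have "0 \<le> l * Re (form x x)"
      using pos[OF x(1)] by simp
    then show "x = 0"
      using x(3) form_pos[of x] by (auto simp: zero_le_mult_iff)
  qed
  have q_split: "\<exists>y z. x = y + z \<and> y \<in> q \<inter> eig 0 \<and> z \<in> q \<inter> nil_part" if x: "x \<in> q" for x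
  proof -
    have "{0..} = {0} \<union> {0::real<..}"
      by auto
    then have "x \<in> graded_part ({0} \<union> {0<..})"
      using x q_sub parabolic_part_def by auto
    then obtain y z where "x = y + z" "y \<in> q" "y \<in> graded_part {0}" "z \<in> q" "z \<in> graded_part {0<..}"
      using invariant_subspace_split[OF subspace_q wq x, of "{0}" "{0<..}"] by auto
    then show ?thesis
      unfolding graded_part_singleton nil_part_def by blast
  qed
  have conj_nil: "conj x \<in> graded_part {..<0}" if "x \<in> nil_part" for x
    using conj_graded_part[of x "{0<..}"] that by (simp add: nil_part_def)
  have mono: "graded_part {..<0} \<subseteq> graded_part {..0}" "graded_part {..<0} \<subseteq> graded_part (- {0})"
      "graded_part {0<..} \<subseteq> graded_part (- {0})"
    by (auto intro!: graded_part_mono)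
  have spanning: "\<exists>a\<in>q \<inter> eig 0. \<exists>b\<in>q \<inter> eig 0. \<exists>c\<in>q \<inter> nil_part. \<exists>d\<in>q \<inter> nil_part.
      x = a + conj b + c + conj d" for x
  proof -
    obtain a b where "a \<in> q" "b \<in> q" and x: "x = a + conj b"
      using q_spanning by blast
    then obtain a1 a2 b1 b2 where
      "a = a1 + a2" "a1 \<in> q \<inter> eig 0" "a2 \<in> q \<inter> nil_part"
      "b = b1 + b2" "b1 \<in> q \<inter> eig 0" "b2 \<in> q \<inter> nil_part"
      using q_split by meson
    moreover from this have "x = a1 + conj b1 + a2 + conj b2"
      by (simp add: x conj_add algebra_simps)
    ultimately show ?thesis
      by blast
  qed
  have disj: "x = 0" if "x \<in> graded_part A" "x \<in> graded_part B" "A \<inter> B = {}" for x A B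
    using graded_part_disjoint that by blast
  note diffs = subspace_diff[OF subspace_graded_part] subspace_add[OF subspace_graded_part]
  \<comment> \<open>Elements of \<open>conj ` q\<close> have no components of positive degree, so those of degree \<open>> 0\<close> in
  \<open>q + conj ` q\<close> come from \<open>q\<close>; similarly for degree zero.\<close>
  have nil_sub: "nil_part \<subseteq> q"
  proof
    fix x assume x: "x \<in> nil_part"
    obtain a b c d where abcd: "a \<in> q \<inter> eig 0" "b \<in> q \<inter> eig 0" "c \<in> q \<inter> nil_part" "d \<in> q \<inter> nil_part"
      "x = a + conj b + c + conj d"
      using spanning by metis
    have "a + conj b + conj d \<in> graded_part {..0}"
      using abcd conj0 conj_nil eig_subset_graded_part[of 0 "{..0}"]
        mono(1) by (intro diffs) auto
    moreover have "x - c \<in> graded_part {0<..}"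
      using x abcd(3) unfolding nil_part_def by (intro diffs) auto
    moreover have "x - c = a + conj b + conj d"
      using abcd(5) by (simp add: algebra_simps)
    ultimately have "x - c = 0"
      by (intro disj[of "x - c" "{0<..}" "{..0}"]) auto
    then show "x \<in> q"
      using abcd(3) by simp
  qed
  have eig0_split: "\<exists>a\<in>q \<inter> eig 0. \<exists>b\<in>q \<inter> eig 0. x = a + conj b" if x: "x \<in> eig 0" for x
  proof -
    obtain a b c d where abcd: "a \<in> q \<inter> eig 0" "b \<in> q \<inter> eig 0" "c \<in> q \<inter> nil_part" "d \<in> q \<inter> nil_part"
      "x = a + conj b + c + conj d"
      using spanning by metis
    have "c + conj d \<in> graded_part (- {0})"
      using abcd(3,4) conj_nil mono(2,3)
      unfolding nil_part_def by (intro diffs) auto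
    moreover have "x - (a + conj b) \<in> eig 0"
      using x abcd(1,2) conj0 subspace_eig by (intro subspace_diff subspace_add) auto
    moreover have "x - (a + conj b) = c + conj d"
      using abcd(5) by (simp add: algebra_simps)
    ultimately have "x - (a + conj b) = 0"
      by (intro disj[of "x - (a + conj b)" "{0}" "- {0}"]) (auto simp: graded_part_singleton)
    then show ?thesis
      using abcd(1,2) by auto
  qed
  \<comment> \<open>In degree zero \<open>\<langle>[w, b], b\<rangle> = 0\<close>, so \<open>conj b\<close> normalizes \<open>q\<close> as well as \<open>b\<close> does.\<close>
  have normalizes: "bracket x y \<in> q" if x: "x \<in> eig 0" and y: "y \<in> q" for x y
  proof -
    obtain a b where "a \<in> q" "b \<in> q \<inter> eig 0" "x = a + conj b"
      using eig0_split[OF x] by blast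
    moreover have "bracket (conj b) y \<in> q"
      using null[of b y] \<open>b \<in> q \<inter> eig 0\<close> y by (simp add: eig_def)
    ultimately show ?thesis
      using y bracket_q subspace_add[OF subspace_q] by (simp add: bracket_add_left)
  qed
  have sub_eig0: "q \<inter> conj ` q \<subseteq> eig 0"
    using q_sub parabolic_Int_conj by blast
  let ?h = "q \<inter> conj ` q"
  have sub_h: "subspace ?h"
    by (intro subspace_inter subspace_conj_image subspace_q)
  have conj_h: "conj x \<in> ?h" if "x \<in> ?h" for x
    using that by (auto simp: mem_conj_image)
  have ideal_h: "bracket x y \<in> ?h" if "x \<in> eig 0" "y \<in> ?h" for x y
    using normalizes[of x y] normalizes[of "conj x" "conj y"] conj0 that
    by (auto simp: mem_conj_image conj_bracket)
  have ideal_perp: "bracket x y \<in> perp ?h" if "x \<in> eig 0" "y \<in> perp ?h" for x y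
    using that ideal_h[OF conj0] by (auto simp: perp_def form_bracket)
  have conj_perp: "conj x \<in> perp ?h" if "x \<in> perp ?h" for x
    unfolding perp_def
  proof (intro CollectI ballI)
    fix y assume "y \<in> ?h"
    then have "form x (conj y) = 0"
      using conj_h that unfolding perp_def by blast
    then show "form (conj x) y = 0"
      using form_conj[of x "conj y"] by simp
  qed
  have h_perp: "x = 0" if "x \<in> ?h" "x \<in> perp ?h" for x
    using that form_self_eq_0 unfolding perp_def by blast
  obtain E where E: "orthonormal_basis ?h E"
    using orthonormal_basis_exists sub_h by blast
  define K where "K = q \<inter> eig 0 \<inter> perp ?h"
  have q0_split: "\<exists>c1\<in>?h. \<exists>c2\<in>K. c = c1 + c2" if "c \<in> q \<inter> eig 0" for c
  proof -
    obtain c1 c2 where c: "c = c1 + c2" "c1 \<in> ?h" "c2 \<in> perp ?h"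
      using perp_decomposition[OF E] by blast
    then have "c2 = c - c1"
      by simp
    moreover have "c1 \<in> eig 0"
      using c(2) sub_eig0 by blast
    ultimately have "c2 \<in> q" "c2 \<in> eig 0"
      using c(2) that subspace_diff[OF subspace_q] subspace_diff[OF subspace_eig] by blast+
    then show ?thesis
      using c by (auto simp: K_def)
  qed
  have KcK: "bracket a (conj b) = 0" if "a \<in> K" "b \<in> K" for a b
  proof (rule h_perp)
    have ab: "a \<in> eig 0" "conj a \<in> eig 0" "b \<in> eig 0" "conj b \<in> eig 0" "a \<in> q" "b \<in> q"
      using that conj0 by (auto simp: K_def)
    have "bracket (conj b) a \<in> q"
      using ab normalizes by blast
    then have "bracket a (conj b) \<in> q"
      using bracket_anti[of a "conj b"] subspace_neg[OF subspace_q] by auto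
    moreover have "bracket (conj a) b \<in> q"
      using ab normalizes by blast
    ultimately show "bracket a (conj b) \<in> ?h"
      by (auto simp: mem_conj_image conj_bracket)
    show "bracket a (conj b) \<in> perp ?h"
      using that ab(1) by (intro ideal_perp conj_perp) (auto simp: K_def)
  qed
  \<comment> \<open>\<open>[a, b]\<close> lies in \<open>K\<close>, hence commutes with \<open>conj a\<close>, hence is orthogonal to itself.\<close>
  have KK: "bracket a b = 0" if "a \<in> K" "b \<in> K" for a b
  proof -
    have "bracket a b \<in> K"
      using that ideal_perp[of a b] normalizes[of a b] subalg0[of a b] by (auto simp: K_def)
    then have "bracket (bracket a b) (conj a) = 0"
      using KcK that(1) by blast
    then have "bracket (conj a) (bracket a b) = 0"
      by (metis bracket_anti neg_equal_0_iff_equal)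
    then have "form (bracket a b) (bracket a b) = 0"
      by (simp add: form_bracket)
    then show ?thesis
      by simp
  qed
  have Kh: "bracket a z = 0" if "a \<in> K" "z \<in> ?h" for a z
  proof (rule h_perp)
    show "bracket a z \<in> ?h"
      using that by (intro ideal_h) (auto simp: K_def)
    have "bracket z a \<in> perp ?h"
      using that sub_eig0 by (intro ideal_perp) (auto simp: K_def)
    then show "bracket a z \<in> perp ?h"
      using bracket_anti[of a z] subspace_neg[OF subspace_perp] by metis
  qed
  have K_central: "bracket a y = 0" if a: "a \<in> K" and y: "y \<in> eig 0" for a y
  proof -
    obtain c d where cd: "c \<in> q \<inter> eig 0" "d \<in> q \<inter> eig 0" "y = c + conj d"
      using eig0_split[OF y] by blast
    obtain c1 c2 where c: "c1 \<in> ?h" "c2 \<in> K" "c = c1 + c2"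
      using q0_split[OF cd(1)] by blast
    obtain d1 d2 where d: "d1 \<in> ?h" "d2 \<in> K" "d = d1 + d2"
      using q0_split[OF cd(2)] by blast
    show ?thesis
      using KK[OF a c(2)] Kh[OF a c(1)] KcK[OF a d(2)] Kh[OF a conj_h[OF d(1)]]
      by (simp add: cd(3) c(3) d(3) conj_add bracket_add_right)
  qed
  show thesis
  proof (rule that)
    show "parabolic parabolic_part"
      by (rule parabolic_parabolic_part)
    show "subspace parabolic_part"
      using subalgebra_parabolic_part by (simp add: subalgebra_def)
    show "q \<inter> conj ` q \<subseteq> parabolic_part"
      using q_sub by blast
    show "nil_radical parabolic_part \<subseteq> q"
      by (simp add: nil_radical_parabolic_part nil_sub)
    show "nil_radical parabolic_part \<inter> conj ` parabolic_part = {0}"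
      unfolding nil_radical_parabolic_part
    proof (intro equalityI subsetI)
      fix x assume "x \<in> nil_part \<inter> conj ` parabolic_part"
      then have "x \<in> nil_part" "x \<in> eig 0"
        using nil_part_subset parabolic_Int_conj by blast+
      then show "x \<in> {0}"
        using disj[of x "{0<..}" "{0}"] by (auto simp: nil_part_def graded_part_singleton)
    qed (use subspace_0[OF subspace_nil_part] nil_part_subset in \<open>force simp: mem_conj_image\<close>)
    show "\<forall>x\<in>q. \<exists>y z. x = y + z \<and> y \<in> q \<inter> (parabolic_part \<inter> conj ` parabolic_part)
        \<and> z \<in> nil_radical parabolic_part"
      using q_split unfolding parabolic_Int_conj nil_radical_parabolic_part by blast
    show "\<forall>x\<in>parabolic_part \<inter> conj ` parabolic_part.
        \<exists>a\<in>q \<inter> (parabolic_part \<inter> conj ` parabolic_part).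
        \<exists>b\<in>q \<inter> (parabolic_part \<inter> conj ` parabolic_part). x = a + conj b"
      using eig0_split unfolding parabolic_Int_conj by blast
    show "\<forall>x\<in>parabolic_part. conj x = x \<longrightarrow> (\<exists>u k. x = u + k \<and> u \<in> ?h \<and> conj u = u
        \<and> (\<forall>y\<in>parabolic_part \<inter> conj ` parabolic_part. bracket k y = 0))"
    proof (intro ballI impI)
      fix x assume "x \<in> parabolic_part" and real: "conj x = x"
      then have "x \<in> eig 0"
        using parabolic_Int_conj by (auto simp: mem_conj_image)
      obtain u k where uk: "x = u + k" "u \<in> ?h" "k \<in> perp ?h"
        using perp_decomposition[OF E] by blast
      have "u - conj u = conj k - k"
        using real uk(1) by (simp add: conj_add algebra_simps)
      then have "u - conj u = 0"
        using uk(2,3) conj_h conj_perp sub_h subspace_perp subspace_diff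
        by (intro h_perp) metis+
      obtain a b where ab: "a \<in> q \<inter> eig 0" "b \<in> q \<inter> eig 0" "x = a + conj b"
        using eig0_split[OF \<open>x \<in> eig 0\<close>] by blast
      obtain a1 a2 where a: "a1 \<in> ?h" "a2 \<in> K" "a = a1 + a2"
        using q0_split[OF ab(1)] by blast
      obtain b1 b2 where b: "b1 \<in> ?h" "b2 \<in> K" "b = b1 + b2"
        using q0_split[OF ab(2)] by blast
      have "k - (a2 + conj b2) = a1 + conj b1 - u"
        using uk(1) ab(3) a(3) b(3) by (simp add: conj_add algebra_simps)
      moreover have "a1 + conj b1 - u \<in> ?h"
        using a(1) conj_h[OF b(1)] uk(2) sub_h by (intro subspace_add subspace_diff) auto
      moreover have "k - (a2 + conj b2) \<in> perp ?h"
        using a(2) b(2) uk(3) conj_perp subspace_perp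
        by (intro subspace_add subspace_diff) (auto simp: K_def)
      ultimately have "k - (a2 + conj b2) = 0"
        by (intro h_perp) simp_all
      then have k: "k = a2 + conj b2"
        by simp
      have "bracket k y = 0" if "y \<in> eig 0" for y
      proof -
        have "bracket (conj b2) y = conj (bracket b2 (conj y))"
          by (simp add: conj_bracket)
        then show ?thesis
          using K_central[OF a(2) that] K_central[OF b(2) conj0[OF that]]
          by (simp add: k bracket_add_left)
      qed
      then show "\<exists>u k. x = u + k \<and> u \<in> ?h \<and> conj u = u
          \<and> (\<forall>y\<in>parabolic_part \<inter> conj ` parabolic_part. bracket k y = 0)"
        using uk(1,2) \<open>u - conj u = 0\<close> unfolding parabolic_Int_conj by (metis eq_iff_diff_eq_0)
    qed
  qed
qed

end


section \<open>The complexification of a compact Lie algebra\<close>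

definition hermitian_extension ::
    "('a::real_vector \<Rightarrow> 'a \<Rightarrow> real) \<Rightarrow> 'a \<times> 'a \<Rightarrow> 'a \<times> 'a \<Rightarrow> complex" where
  "hermitian_extension ip = (\<lambda>(x, y) (x', y'). Complex (ip x x' + ip y y') (ip y x' - ip x y'))"

definition pair_conj :: "'a::real_vector \<times> 'a \<Rightarrow> 'a \<times> 'a" where
  "pair_conj = (\<lambda>(x, y). (x, - y))"

lemma pair_conj_simp [simp]: "pair_conj (x, y) = (x, - y)"
  by (simp add: pair_conj_def)

lemma complexification_finite_spanning:
  assumes "finite_dimensional_vector_space (*\<^sub>R) (Bs :: 'a::real_vector set)"
  shows "\<exists>S :: ('a \<times> 'a) set. finite S \<and> module.span cscale S = UNIV"
proof -
  interpret F: finite_dimensional_vector_space "(*\<^sub>R)" Bs by fact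
  interpret C: vector_space "cscale :: complex \<Rightarrow> 'a \<times> 'a \<Rightarrow> _" by (rule vector_space_cscale)
  let ?S = "(\<lambda>b. (b, 0 :: 'a)) ` Bs"
  have "subspace {x. (x, 0) \<in> C.span ?S}"
    unfolding subspace_def
  proof (intro conjI allI ballI)
    show "0 \<in> {x. (x, 0) \<in> C.span ?S}"
      using C.span_zero[of ?S] by (simp add: zero_prod_def)
    fix x y c
    assume x: "x \<in> {x. (x, 0) \<in> C.span ?S}"
    then show "c *\<^sub>R x \<in> {x. (x, 0) \<in> C.span ?S}"
      using C.span_scale[of "(x, 0)" ?S "of_real c"] by (simp add: cscale_def)
    assume y: "y \<in> {x. (x, 0) \<in> C.span ?S}"
    with x show "x + y \<in> {x. (x, 0) \<in> C.span ?S}"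
      using C.span_add[of "(x, 0)" ?S "(y, 0)"] by simp
  qed
  moreover have "Bs \<subseteq> {x. (x, 0) \<in> C.span ?S}"
    by (auto intro: C.span_base)
  ultimately have "span Bs \<subseteq> {x. (x, 0) \<in> C.span ?S}"
    by (simp add: span_minimal)
  then have real: "(x, 0) \<in> C.span ?S" for x
    using F.span_Basis by (auto simp: span_raw_def)
  have "(x, y) \<in> C.span ?S" for x y
    using C.span_add[OF real[of x] C.span_scale[OF real[of y], of \<i>]] by (simp add: cscale_def)
  then show ?thesis
    using F.finite_Basis by (intro exI[of _ ?S]) auto
qed

text \<open>Pairs \<open>(x, y)\<close> stand for \<open>x + \<i> y\<close>. The adjunction between \<open>ad a\<close> and \<open>- ad (conj a)\<close> is the
  invariance of the inner product, read off in real and imaginary parts.\<close>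

lemma unitary_complexification:
  fixes br :: "'a::real_vector \<Rightarrow> 'a \<Rightarrow> 'a"
  assumes "lie_algebra (*\<^sub>R) br"
    and "finite_dimensional_vector_space (*\<^sub>R) (Bs :: 'a set)"
    and ip: "invariant_inner_product br ip"
  shows "unitary_lie_algebra cscale (hermitian_extension ip) (cbracket br) pair_conj"
proof -
  interpret L: lie_algebra "(*\<^sub>R)" br by fact
  interpret C: lie_algebra cscale "cbracket br" by (rule lie_algebra_complexification) fact
  have bil: "bilinear ip" and sym: "\<And>x y. ip x y = ip y x" and pos: "\<And>x. x \<noteq> 0 \<Longrightarrow> ip x x > 0"
    and inv: "\<And>x y z. ip (br x y) z = - ip y (br x z)"
    using ip by (auto simp: invariant_inner_product_def eq_neg_iff_add_eq_0)
  note lin = bilinear_ladd[OF bil] bilinear_radd[OF bil] bilinear_lmul[OF bil] bilinear_rmul[OF bil]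
    bilinear_lneg[OF bil] bilinear_rneg[OF bil] bilinear_lsub[OF bil] bilinear_rsub[OF bil]
    bilinear_lzero[OF bil] bilinear_rzero[OF bil]
  have br_minus: "br (- x) y = - br x y" "br x (- y) = - br x y" for x y
    using L.bracket_scale_left[of "-1" x y] L.bracket_scale_right[of x "-1" y] by simp_all
  show ?thesis
  proof unfold_locales
    show "\<exists>S :: ('a \<times> 'a) set. finite S \<and> module.span cscale S = UNIV"
      using complexification_finite_spanning assms(2) by blast
    fix x y z a :: "'a \<times> 'a" and c :: complex
    obtain x1 x2 y1 y2 z1 z2 a1 a2 where [simp]: "x = (x1, x2)" "y = (y1, y2)" "z = (z1, z2)" "a = (a1, a2)"
      by (cases x, cases y, cases z, cases a) auto
    let ?H = "hermitian_extension ip"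
    show "?H (x + y) z = ?H x z + ?H y z"
      by (simp add: hermitian_extension_def lin complex_eq_iff)
    show "?H (cscale c x) y = c * ?H x y"
      by (simp add: hermitian_extension_def cscale_def lin complex_eq_iff algebra_simps)
    show "cnj (?H x y) = ?H y x"
      using sym by (simp add: hermitian_extension_def complex_eq_iff)
    show "0 < Re (?H x x)" if "x \<noteq> 0"
    proof -
      have "0 \<le> ip x1 x1" "0 \<le> ip x2 x2"
        using pos[of x1] pos[of x2] lin by (cases "x1 = 0"; cases "x2 = 0"; simp)+
      moreover have "0 < ip x1 x1 \<or> 0 < ip x2 x2"
        using that pos by (auto simp: zero_prod_def)
      ultimately show ?thesis
        by (auto simp: hermitian_extension_def)
    qed
    show "pair_conj (x + y) = pair_conj x + pair_conj y"
      by simp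
    show "pair_conj (cscale c x) = cscale (cnj c) (pair_conj x)"
      by (simp add: cscale_def)
    show "pair_conj (pair_conj x) = x"
      by simp
    show "pair_conj (cbracket br x y) = cbracket br (pair_conj x) (pair_conj y)"
      by (simp add: cbracket_def br_minus)
    show "?H (pair_conj x) (pair_conj y) = cnj (?H x y)"
      by (simp add: hermitian_extension_def lin complex_eq_iff)
    show "?H (cbracket br a x) y = - ?H x (cbracket br (pair_conj a) y)"
      by (simp add: hermitian_extension_def cbracket_def lin br_minus inv complex_eq_iff)
  qed
qed


section \<open>Complex structures on quotients\<close>

context
  fixes h :: "'a::real_vector set"
  assumes h: "subspace h"
begin

lemma proj_eq_iff: "proj h x = proj h y \<longleftrightarrow> x - y \<in> h"
proof
  assume "proj h x = proj h y"
  moreover have "x \<in> proj h x"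
    using subspace_0[OF h] by (auto simp: proj_def elt_set_plus_def)
  ultimately show "x - y \<in> h"
    by (auto simp: proj_def elt_set_plus_def)
next
  assume xy: "x - y \<in> h"
  show "proj h x = proj h y"
    unfolding proj_def elt_set_plus_def
  proof safe
    fix z assume "z \<in> h"
    then show "\<exists>b\<in>h. x + z = y + b" "\<exists>b\<in>h. y + z = x + b"
      using xy subspace_add[OF h, of "x - y" z] subspace_diff[OF h, of z "x - y"]
      by (intro bexI[of _ "x - y + z"] bexI[of _ "z - (x - y)"]; simp)+
  qed
qed

lemma proj_add: "proj h x + proj h y = proj h (x + y)"
proof (intro equalityI subsetI)
  fix z assume "z \<in> proj h x + proj h y"
  then obtain a b where "a \<in> h" "b \<in> h" "z = (x + a) + (y + b)"
    by (auto simp: proj_def elt_set_plus_def set_plus_def)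
  then show "z \<in> proj h (x + y)"
    using subspace_add[OF h, of a b] by (auto simp: proj_def elt_set_plus_def intro!: bexI[of _ "a + b"])
next
  fix z assume "z \<in> proj h (x + y)"
  then obtain a where "a \<in> h" "z = (x + a) + (y + 0)"
    by (auto simp: proj_def elt_set_plus_def algebra_simps)
  then show "z \<in> proj h x + proj h y"
    using subspace_0[OF h] by (auto simp: proj_def elt_set_plus_def set_plus_def)
qed

lemma qscale_proj: "qscale h r (proj h x) = proj h (r *\<^sub>R x)"
  by (rule induced_proj) (use h in \<open>auto simp: subspace_scale intro: linear_scaleR\<close>)

lemma quminus_proj: "quminus h (proj h x) = proj h (- x)"
  by (rule induced_proj) (use h in \<open>auto simp: subspace_neg intro: linear_uminus\<close>)

lemma proj_in_quot_iff:
  assumes "subspace m" "h \<subseteq> m"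
  shows "proj h x \<in> quot m h \<longleftrightarrow> x \<in> m"
proof
  assume "proj h x \<in> quot m h"
  then obtain y where "y \<in> m" "x - y \<in> h"
    by (auto simp: quot_def proj_eq_iff)
  then show "x \<in> m"
    using assms subspace_add[of m "x - y" y] by auto
qed (simp add: quot_def)

text \<open>To avoid computing with cosets, a complex structure is handled through the relation
  \<open>J (proj h x) = proj h x'\<close> between representatives.\<close>

context
  fixes m J
  assumes m: "subspace m" "h \<subseteq> m" and J: "complex_structure m h J"
begin

lemma representative_exists:
  assumes "x \<in> m"
  obtains x' where "x' \<in> m" "J (proj h x) = proj h x'"
proof -
  have "J (proj h x) \<in> quot m h"
    using J assms by (auto simp: complex_structure_def quot_def)
  then show thesis
    using that by (auto simp: quot_def)
qed

lemma representative_add: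
  assumes "x \<in> m" "y \<in> m" "J (proj h x) = proj h x'" "J (proj h y) = proj h y'"
  shows "J (proj h (x + y)) = proj h (x' + y')"
proof -
  have "J (proj h x + proj h y) = J (proj h x) + J (proj h y)"
    using J assms(1,2) unfolding complex_structure_def quot_def by blast
  then show ?thesis
    by (simp add: proj_add assms(3,4))
qed

lemma representative_scale:
  assumes "x \<in> m" "J (proj h x) = proj h x'"
  shows "J (proj h (r *\<^sub>R x)) = proj h (r *\<^sub>R x')"
proof -
  have "J (qscale h r (proj h x)) = qscale h r (J (proj h x))"
    using J assms(1) unfolding complex_structure_def quot_def by blast
  then show ?thesis
    by (simp add: qscale_proj assms(2))
qed

lemma representative_swap:
  assumes "x \<in> m" "J (proj h x) = proj h x'"
  shows "J (proj h x') = proj h (- x)"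
proof -
  have "J (J (proj h x)) = quminus h (proj h x)"
    using J assms(1) unfolding complex_structure_def quot_def by blast
  then show ?thesis
    by (simp add: quminus_proj assms(2))
qed

text \<open>For \<open>x + \<i> y\<close> to lie in the eigenspace it suffices that \<open>J\<close> sends the class of \<open>x\<close> to that of
  \<open>- y\<close>; the other component of the eigenvalue equation follows by applying \<open>J\<close>.\<close>

lemma vimage_plus_eigenspace:
  "cproj h -` plus_eigenspace m h J = {(x, y). x \<in> m \<and> y \<in> m \<and> J (proj h x) = proj h (- y)}"
proof -
  have swap: "J (proj h y) = proj h x" if "x \<in> m" "y \<in> m" "J (proj h x) = proj h (- y)" for x y
  proof -
    have "- y \<in> m"
      using that(2) m(1) subspace_neg by blast
    then show ?thesis
      using representative_scale[OF _ representative_swap[OF that(1,3)], of "-1"] by simp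
  qed
  have "(x, y) \<in> cproj h -` plus_eigenspace m h J
      \<longleftrightarrow> x \<in> m \<and> y \<in> m \<and> J (proj h x) = proj h (- y) \<and> J (proj h y) = proj h x" for x y
    by (simp add: cproj_def plus_eigenspace_def proj_in_quot_iff[OF m] quminus_proj)
  then show ?thesis
    using swap by blast
qed

end

lemma complex_structure_eqI:
  assumes J: "complex_structure UNIV h J" and J': "complex_structure UNIV h J'"
    and eq: "cproj h -` plus_eigenspace UNIV h J = cproj h -` plus_eigenspace UNIV h J'"
  shows "J = J'"
proof (rule PiE_ext)
  show "J \<in> quot UNIV h \<rightarrow>\<^sub>E quot UNIV h" "J' \<in> quot UNIV h \<rightarrow>\<^sub>E quot UNIV h"
    using J J' by (auto simp: complex_structure_def)
  fix u assume "u \<in> quot UNIV h"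
  then obtain x where u: "u = proj h x"
    by (auto simp: quot_def)
  obtain x' where x': "J (proj h x) = proj h x'"
    using representative_exists[OF _ _ J, of x] by auto
  then have "(x, - x') \<in> cproj h -` plus_eigenspace UNIV h J"
    using vimage_plus_eigenspace[OF _ _ J] by simp
  then have "J' (proj h x) = proj h x'"
    using vimage_plus_eigenspace[OF _ _ J'] eq by simp
  then show "J u = J' u"
    using u x' by simp
qed

lemma complex_structure_restrict:
  assumes J: "complex_structure UNIV h J" and m: "subspace m" "h \<subseteq> m"
    and inv: "\<And>x. x \<in> m \<Longrightarrow> \<exists>x'\<in>m. J (proj h x) = proj h x'"
  shows "complex_structure m h (restrict J (quot m h))"
proof -
  have clo: "proj h x + proj h y \<in> quot m h" "qscale h r (proj h x) \<in> quot m h"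
    if "x \<in> m" "y \<in> m" for x y r
    using that m(1) by (auto simp: proj_add qscale_proj quot_def subspace_add subspace_scale)
  have J_m: "J (proj h x) \<in> quot m h" if "x \<in> m" for x
    using inv[OF that] by (auto simp: quot_def)
  have "J (u + v) = J u + J v" "J (qscale h r u) = qscale h r (J u)" "J (J u) = quminus h u"
    if "u \<in> quot m h" "v \<in> quot m h" for u v r
    using J that unfolding complex_structure_def quot_def by blast+
  moreover have "u + v \<in> quot m h" "qscale h r u \<in> quot m h" "J u \<in> quot m h"
    if "u \<in> quot m h" "v \<in> quot m h" for u v r
    using that clo J_m by (auto simp: quot_def[of m])
  ultimately show ?thesis
    unfolding complex_structure_def by auto
qed

end


section \<open>Invariant complex structures and parabolic subalgebras\<close>

text \<open>If \<open>J\<close> sends \<open>x\<close>, \<open>y\<close> to \<open>x'\<close>, \<open>y'\<close> then \<open>x - \<i> x'\<close> and \<open>y - \<i> y'\<close> lie in the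
  \<open>\<i>\<close>-eigenspace, and their bracket has real part \<open>[x, y] - [x', y']\<close> and imaginary part
  \<open>- ([x', y] + [x, y'])\<close>. Integrability says that \<open>J\<close> sends the class of the former to minus the
  class of the latter, so that the bracket lies in the eigenspace as well.\<close>

lemma transversal_of_integrable:
  fixes br :: "'a::real_vector \<Rightarrow> 'a \<Rightarrow> 'a"
  assumes "lie_algebra (*\<^sub>R) br" "finite_dimensional_vector_space (*\<^sub>R) (Bs :: 'a set)"
    and "invariant_inner_product br ip" and h: "subspace h"
    and J: "complex_structure UNIV h J" and int: "integrable_structure br h J"
  shows "transversal_subalgebra cscale (hermitian_extension ip) (cbracket br) pair_conj
    (cproj h -` plus_eigenspace UNIV h J)"
proof -
  interpret unitary_lie_algebra cscale "hermitian_extension ip" "cbracket br" pair_conj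
    by (rule unitary_complexification) fact+
  define R where "R x x' \<longleftrightarrow> J (proj h x) = proj h x'" for x x'
  have ex: "\<exists>x'. R x x'" for x
    unfolding R_def using representative_exists[OF h _ _ J, of x] by auto
  have add: "R (x + y) (x' + y')" if "R x x'" "R y y'" for x y x' y'
    using representative_add[OF h _ _ J, of x y] that by (simp add: R_def)
  have scale: "R (r *\<^sub>R x) (r *\<^sub>R x')" if "R x x'" for r x x'
    using representative_scale[OF h _ _ J, of x] that by (simp add: R_def)
  have swap: "R x' (- x)" if "R x x'" for x x'
    using representative_swap[OF h _ _ J, of x] that by (simp add: R_def)
  have neg: "R (- x) (- x')" if "R x x'" for x x'
    using scale[OF that, of "-1"] by simp
  have integ: "R (br x' y + br x y') (br x' y' - br x y)" if "R x x'" "R y y'" for x y x' y'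
  proof -
    obtain t where t: "R (br x' y + br x y') t"
      using ex by blast
    then have "proj h (br x y + t + - br x' y') = proj h 0"
      using int that unfolding integrable_structure_def R_def
      by (metis proj_add[OF h] quminus_proj[OF h])
    then have "proj h t = proj h (br x' y' - br x y)"
      by (simp add: proj_eq_iff[OF h] algebra_simps)
    then show ?thesis
      using t by (simp add: R_def)
  qed
  define q where "q = cproj h -` plus_eigenspace UNIV h J"
  have q_iff: "z \<in> q \<longleftrightarrow> R (fst z) (- snd z)" for z
    using vimage_plus_eigenspace[OF h _ _ J] by (cases z) (simp add: R_def q_def)
  have "subspace q"
  proof (rule subspaceI)
    show "0 \<in> q"
      using scale[of 0 _ 0] ex[of 0] q_iff by (auto simp: zero_prod_def)
    show "z + z' \<in> q" if "z \<in> q" "z' \<in> q" for z z'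
      using add[of "fst z" "- snd z" "fst z'" "- snd z'"] that by (simp add: q_iff)
    show "cscale c z \<in> q" if "z \<in> q" for c z
    proof -
      obtain x y where z: "z = (x, y)"
        by (cases z)
      then have "R x (- y)"
        using that q_iff by simp
      then have "R (Re c *\<^sub>R x) (Re c *\<^sub>R - y)" "R (Im c *\<^sub>R - y) (Im c *\<^sub>R - x)"
        using scale swap by blast+
      from add[OF this] show ?thesis
        by (simp add: q_iff z cscale_def add.commute)
    qed
  qed
  moreover have "cbracket br z z' \<in> q" if zz': "z \<in> q" "z' \<in> q" for z z'
  proof -
    obtain x y x' y' where z: "z = (x, y)" "z' = (x', y')"
      by (cases z, cases z')
    have R: "R x (- y)" "R x' (- y')"
      using zz' q_iff z by simp_all
    interpret L: lie_algebra "(*\<^sub>R)" br by fact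
    have br_minus: "br (- x) y = - br x y" "br x (- y) = - br x y" for x y
      using L.bracket_scale_left[of "-1" x y] L.bracket_scale_right[of x "-1" y] by simp_all
    from neg[OF swap[OF integ[OF R]]] show ?thesis
      by (simp add: q_iff z cbracket_def br_minus add.commute)
  qed
  moreover have "\<exists>a\<in>q. \<exists>b\<in>q. z = a + pair_conj b" for z
  proof -
    obtain x y where z: "z = (x, y)"
      by (cases z)
    obtain x' y' where R: "R x x'" "R y y'"
      using ex by blast
    \<comment> \<open>To write \<open>x + \<i> y\<close> as \<open>(a - \<i> a') + (b + \<i> b')\<close> with \<open>a'\<close>, \<open>b'\<close> images of \<open>a\<close>, \<open>b\<close>, one needs
    \<open>a + b = x\<close> and \<open>b' - a' = y\<close>, that is \<open>a - b = y'\<close>.\<close>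
    have "R (x + y') (x' - y)" "R (x - y') (x' + y)"
      using add[OF R(1) swap[OF R(2)]] add[OF R(1) neg[OF swap[OF R(2)]]] by simp_all
    from this[THEN scale, of "1/2"] have
      "((1/2) *\<^sub>R (x + y'), - (1/2) *\<^sub>R (x' - y)) \<in> q" "((1/2) *\<^sub>R (x - y'), - (1/2) *\<^sub>R (x' + y)) \<in> q"
      using q_iff by simp_all
    moreover have "z = ((1/2) *\<^sub>R (x + y'), - (1/2) *\<^sub>R (x' - y))
        + pair_conj ((1/2) *\<^sub>R (x - y'), - (1/2) *\<^sub>R (x' + y))"
      by (simp add: z flip: scaleR_add_right scaleR_diff_right)
    ultimately show ?thesis
      by blast
  qed
  ultimately show ?thesis
    unfolding q_def[symmetric] by unfold_locales (auto simp: subalgebra_def)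
qed

text \<open>The intersection is conjugation-stable, and a conjugation-stable complex subspace contains
  the real and imaginary parts of its elements.\<close>

lemma real_points_Int_conj:
  assumes "module.subspace cscale P"
  shows "P \<inter> pair_conj ` P = real_points P \<times> real_points P"
proof -
  interpret C: vector_space "cscale :: complex \<Rightarrow> 'a \<times> 'a::real_vector \<Rightarrow> _" by (rule vector_space_cscale)
  have conj_image: "(x, y) \<in> pair_conj ` P \<longleftrightarrow> (x, - y) \<in> P" for x y
    by (force simp: pair_conj_def)
  show ?thesis
  proof (intro equalityI subsetI)
    fix z assume "z \<in> P \<inter> pair_conj ` P"
    then obtain x y where z: "z = (x, y)" "(x, y) \<in> P" "(x, - y) \<in> P"
      using conj_image by (cases z) auto
    have "cscale (1/2) ((x, y) + (x, - y)) \<in> P" "cscale (- \<i>/2) ((x, y) - (x, - y)) \<in> P"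
      using z assms by (simp_all only: C.subspace_scale C.subspace_add C.subspace_diff)
    then have "(x, 0) \<in> P" "(y, 0) \<in> P"
      by (simp_all add: cscale_def flip: scaleR_2)
    then show "z \<in> real_points P \<times> real_points P"
      by (simp add: z real_points_def)
  next
    fix z assume "z \<in> real_points P \<times> real_points P"
    then obtain x y where z: "z = (x, y)" "(x, 0) \<in> P" "(y, 0) \<in> P"
      by (auto simp: real_points_def)
    then have "(x, 0) + cscale \<i> (y, 0) \<in> P" "(x, 0) - cscale \<i> (y, 0) \<in> P"
      using assms by (simp_all only: C.subspace_scale C.subspace_add C.subspace_diff)
    then show "z \<in> P \<inter> pair_conj ` P"
      by (simp add: z conj_image cscale_def)
  qed
qed

lemma subspace_real_points:
  assumes "module.subspace cscale P"
  shows "subspace (real_points P)"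
proof -
  interpret C: vector_space "cscale :: complex \<Rightarrow> 'a \<times> 'a::real_vector \<Rightarrow> _" by (rule vector_space_cscale)
  show ?thesis
  proof (rule subspaceI)
    show "0 \<in> real_points P"
      using C.subspace_0[OF assms] by (simp add: real_points_def zero_prod_def)
    show "x + y \<in> real_points P" if "x \<in> real_points P" "y \<in> real_points P" for x y
      using C.subspace_add[OF assms, of "(x, 0)" "(y, 0)"] that by (simp add: real_points_def)
    show "c *\<^sub>R x \<in> real_points P" if "x \<in> real_points P" for c x
      using C.subspace_scale[OF assms, of "(x, 0)" "of_real c"] that
      by (simp add: real_points_def cscale_def)
  qed
qed

theorem theorem1p3:
  fixes br :: "'a::real_vector \<Rightarrow> 'a \<Rightarrow> 'a"
    and h :: "'a set"
    and J :: "'a set \<Rightarrow> 'a set"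
  assumes "lie_algebra (*\<^sub>R) br"
    and "\<exists>Basis :: 'a set. finite_dimensional_vector_space (*\<^sub>R) Basis"
    and "\<exists>ip. invariant_inner_product br ip"
    and "lie_algebra.subalgebra (*\<^sub>R) br h"
    and "even (quot_dim h)"
    and "\<exists>m a. lie_algebra.subalgebra (*\<^sub>R) br m \<and>
           lie_algebra.subalgebra (*\<^sub>R) br a \<and> lie_algebra.abelian br a \<and>
           m = lie_algebra.centralizer br a \<and> h \<subseteq> m \<and>
           lie_algebra.bracket_span (*\<^sub>R) br m m = lie_algebra.bracket_span (*\<^sub>R) br h h"
    and "complex_structure UNIV h J"
    and "ad_invariant br h J"
    and "integrable_structure br h J"
  shows "\<exists>P J\<^sub>1. lie_algebra.parabolic cscale (cbracket br) P \<and>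
           h \<subseteq> real_points P \<and>
           lie_algebra.bracket_span (*\<^sub>R) br (real_points P) (real_points P)
             = lie_algebra.bracket_span (*\<^sub>R) br h h \<and>
           complex_structure (real_points P) h J\<^sub>1 \<and>
           J = parabolic_structure br h P J\<^sub>1"
proof -
  interpret L: lie_algebra "(*\<^sub>R)" br by fact
  have h: "subspace h"
    using assms(4) by (simp add: L.subalgebra_def subspace_raw_def)
  note bracket_span = L.bracket_span_def[folded span_raw_def]
  note J = assms(7)
  obtain Bs :: "'a set" and ip where "finite_dimensional_vector_space (*\<^sub>R) Bs" "invariant_inner_product br ip"
    using assms(2,3) by blast
  define q where "q = cproj h -` plus_eigenspace UNIV h J"
  interpret C: transversal_subalgebra cscale "hermitian_extension ip" "cbracket br" pair_conj q
    unfolding q_def by (rule transversal_of_integrable) fact+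
  have q: "(x, y) \<in> q \<longleftrightarrow> J (proj h x) = proj h (- y)" for x y
    using vimage_plus_eigenspace[OF h _ _ J] by (simp add: q_def)
  have h_q: "(x, 0) \<in> q \<longleftrightarrow> x \<in> h" for x
  proof
    assume "(x, 0) \<in> q"
    then have *: "J (proj h x) = proj h 0"
      using q by simp
    have "J (proj h 0) = proj h 0"
      using representative_scale[OF h _ _ J, of x 0 0] * by simp
    moreover have "J (proj h 0) = proj h (- x)"
      using representative_swap[OF h _ _ J, of x 0] * by simp
    ultimately show "x \<in> h"
      using proj_eq_iff[OF h, of 0 "- x"] by simp
  next
    assume "x \<in> h"
    then have "proj h x = proj h 0"
      by (simp add: proj_eq_iff[OF h])
    moreover obtain t where "J (proj h 0) = proj h t"
      using representative_exists[OF h _ _ J, of 0] by auto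
    then have "J (proj h 0) = proj h 0"
      using representative_scale[OF h _ _ J, of 0 t 0] by simp
    ultimately show "(x, 0) \<in> q"
      by (simp add: q)
  qed
  obtain P where P: "C.parabolic P" "C.subspace P" "q \<inter> pair_conj ` q \<subseteq> P"
    and n: "C.nil_radical P \<subseteq> q" "C.nil_radical P \<inter> pair_conj ` P = {0}"
    and q_split: "\<forall>x\<in>q. \<exists>y z. x = y + z \<and> y \<in> q \<inter> (P \<inter> pair_conj ` P) \<and> z \<in> C.nil_radical P"
    and m_split: "\<forall>x\<in>P \<inter> pair_conj ` P.
      \<exists>a\<in>q \<inter> (P \<inter> pair_conj ` P). \<exists>b\<in>q \<inter> (P \<inter> pair_conj ` P). x = a + pair_conj b"
    and central: "\<forall>x\<in>P. pair_conj x = x \<longrightarrow>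
      (\<exists>u k. x = u + k \<and> u \<in> q \<inter> pair_conj ` q \<and> pair_conj u = u
        \<and> (\<forall>y\<in>P \<inter> pair_conj ` P. cbracket br k y = 0))"
    by (rule C.parabolic_of_transversal)
  define m where "m = real_points P"
  have m: "subspace m" and PP: "P \<inter> pair_conj ` P = m \<times> m"
    using subspace_real_points[OF P(2)] real_points_Int_conj[OF P(2)] by (simp_all add: m_def)
  have "(x, 0) \<in> pair_conj ` q" if "(x, 0) \<in> q" for x
    using that by (force simp: C.mem_conj_image)
  then have hm: "h \<subseteq> m"
    using P(3) h_q by (auto simp: m_def real_points_def)

  \<comment> \<open>Up to elements commuting with \<open>m\<close>, the subalgebra \<open>m\<close> reduces to \<open>h\<close>.\<close>
  have commutators: "\<exists>u\<in>h. \<exists>k. x = u + k \<and> (\<forall>y\<in>m. br k y = 0)" if "x \<in> m" for x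
  proof -
    have "(x, 0) \<in> P"
      using that by (simp add: m_def real_points_def)
    then obtain u k where uk: "(x, 0) = u + k" "u \<in> q" "pair_conj u = u"
        "\<forall>y\<in>m \<times> m. cbracket br k y = 0"
      using central[rule_format, of "(x, 0)"] PP by auto
    obtain u1 u2 k1 k2 where u: "u = (u1, u2)" and k: "k = (k1, k2)"
      by (cases u, cases k)
    have "2 *\<^sub>R u2 = 0"
      using uk(3) by (simp add: u scaleR_2 neg_eq_iff_add_eq_0)
    then have "u2 = 0"
      by simp
    have "br k1 y = 0" if "y \<in> m" for y
    proof -
      have "cbracket br (k1, k2) (y, 0) = 0"
        using uk(4) that subspace_0[OF m] k by auto
      moreover have "br k2 0 = 0"
        using L.bracket_scale_right[of k2 0 0] by simp
      ultimately show ?thesis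
        by (simp add: cbracket_def zero_prod_def)
    qed
    moreover have "u1 \<in> h" "x = u1 + k1"
      using uk(1,2) h_q \<open>u2 = 0\<close> by (auto simp: u k)
    ultimately show ?thesis
      by blast
  qed
  have "L.bracket_span m m = L.bracket_span h h"
  proof
    have "br x y \<in> L.bracket_span h h" if xy: "x \<in> m" "y \<in> m" for x y
    proof -
      obtain u k where u: "u \<in> h" "x = u + k" "\<forall>y\<in>m. br k y = 0"
        using commutators[OF xy(1)] by blast
      obtain v l where v: "v \<in> h" "y = v + l" "\<forall>y\<in>m. br l y = 0"
        using commutators[OF xy(2)] by blast
      have "br (u + l) (u + l) = br u u + br u l + (br l u + br l l)"
        by (simp only: L.bracket_add_left L.bracket_add_right ac_simps)
      then have "br u l = - br l u"
        by (simp add: L.bracket_self eq_neg_iff_add_eq_0)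
      then have "br u l = 0"
        using v(3) u(1) hm by auto
      moreover have "br k y = 0"
        using u(3) xy(2) by blast
      ultimately have "br x y = br u v"
        using v(2) by (simp add: u(2) L.bracket_add_left L.bracket_add_right)
      then show ?thesis
        using u(1) v(1) by (auto simp: bracket_span intro!: span_base)
    qed
    then show "L.bracket_span m m \<subseteq> L.bracket_span h h"
      unfolding bracket_span[of m m] by (intro span_minimal) (auto simp: bracket_span)
    show "L.bracket_span h h \<subseteq> L.bracket_span m m"
      unfolding bracket_span using hm by (intro span_mono) blast
  qed

  \<comment> \<open>If \<open>x = a + conj b\<close> with \<open>a = a1 + \<i> a2\<close> and \<open>b = b1 + \<i> b2\<close> in \<open>q\<close>, then \<open>J\<close> sends the class of
  \<open>x = a1 + b1\<close> to that of \<open>- a2 - b2\<close>, and all components lie in \<open>m\<close>.\<close>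
  have J_m: "\<exists>x'\<in>m. J (proj h x) = proj h x'" if "x \<in> m" for x
  proof -
    have "(x, 0) \<in> m \<times> m"
      using that subspace_0[OF m] by simp
    then obtain a1 a2 b1 b2 where ab: "(a1, a2) \<in> q" "(a1, a2) \<in> m \<times> m" "(b1, b2) \<in> q" "(b1, b2) \<in> m \<times> m"
      "(x, 0) = (a1, a2) + pair_conj (b1, b2)"
      using m_split[rule_format, of "(x, 0)"] unfolding PP by (metis IntE prod.collapse)
    then have "J (proj h (a1 + b1)) = proj h (- a2 + - b2)"
      by (intro representative_add[OF h _ _ J]) (auto simp: q)
    then show ?thesis
      using ab subspace_diff[OF m, of "- a2" b2] subspace_neg[OF m, of a2]
      by (auto intro!: bexI[of _ "- a2 - b2"])
  qed
  define J\<^sub>1 where "J\<^sub>1 = restrict J (quot m h)"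
  have J\<^sub>1: "complex_structure m h J\<^sub>1"
    unfolding J\<^sub>1_def by (rule complex_structure_restrict[OF h J m hm J_m])
  have plus_m: "cproj h -` plus_eigenspace m h J\<^sub>1 = q \<inter> (P \<inter> pair_conj ` P)"
    unfolding vimage_plus_eigenspace[OF h m hm J\<^sub>1] PP
    by (auto simp: J\<^sub>1_def q quot_def)
  have "direct_sum_of q (cproj h -` plus_eigenspace m h J\<^sub>1) (C.nil_radical P)"
    unfolding direct_sum_of_def plus_m
  proof
    show "q = q \<inter> (P \<inter> pair_conj ` P) + C.nil_radical P"
    proof (intro equalityI subsetI)
      fix x assume "x \<in> q"
      then show "x \<in> q \<inter> (P \<inter> pair_conj ` P) + C.nil_radical P"
        using q_split set_plus_intro by metis
    next
      fix x assume "x \<in> q \<inter> (P \<inter> pair_conj ` P) + C.nil_radical P"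
      then obtain a b where ab: "x = a + b" "a \<in> q \<inter> (P \<inter> pair_conj ` P)" "b \<in> C.nil_radical P"
        by (rule set_plus_elim)
      then have "a \<in> q" "b \<in> q"
        using n(1) by auto
      then show "x \<in> q"
        unfolding ab(1) by (rule C.subspace_add[OF C.subspace_q])
    qed
    have "0 \<in> q" "0 \<in> P \<inter> pair_conj ` P"
      using C.subspace_0[OF C.subspace_q] subspace_0[OF m] by (simp_all add: PP zero_prod_def)
    moreover have "0 \<in> C.nil_radical P"
      using n(2) by blast
    ultimately have "{0} \<subseteq> q \<inter> (P \<inter> pair_conj ` P) \<inter> C.nil_radical P"
      by simp
    moreover have "q \<inter> (P \<inter> pair_conj ` P) \<inter> C.nil_radical P \<subseteq> C.nil_radical P \<inter> pair_conj ` P"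
      by (rule subsetI) (simp only: Int_iff)
    ultimately show "q \<inter> (P \<inter> pair_conj ` P) \<inter> C.nil_radical P = {0}"
      using n(2) by (metis subset_antisym)
  qed
  then have "J = parabolic_structure br h P J\<^sub>1"
    unfolding parabolic_structure_def m_def[symmetric]
  proof (intro the_equality[symmetric] conjI)
    fix J' assume "complex_structure UNIV h J' \<and>
        direct_sum_of (cproj h -` plus_eigenspace UNIV h J') (cproj h -` plus_eigenspace m h J\<^sub>1)
          (C.nil_radical P)"
    then show "J' = J"
      using complex_structure_eqI[OF h _ J, of J'] \<open>direct_sum_of q _ _\<close>
      by (simp add: q_def direct_sum_of_def)
  qed (use J in \<open>simp_all add: q_def\<close>)
  then show ?thesis
    using P(1) hm \<open>L.bracket_span m m = L.bracket_span h h\<close> J\<^sub>1 unfolding m_def by blast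
qed

end
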